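(* Let $f:\mathbb{D}\to\widehat{\mathbb{C}}$ be spherically convex. Then $$\mathcal{A}_s(r):=\frac{A_s f(r\mathbb{D})}{A_s(r\mathbb{D})}$$ is a strictly increasing function of $r\in(0,1)$, unless $f$ is a spherical isometry, in which case $\mathcal{A}_s(r)\equiv 1$.
   Context: $\mathbb{D}=\{z\in\mathbb{C}:|z|<1\}$, $\widehat{\mathbb{C}}=\mathbb{C}\cup\{\infty\}$ is the Riemann sphere with the spherical metric $\frac{|dz|}{1+|z|^2}$ (Gaussian curvature $+4$). For two non-antipodal points $a,b\in\widehat{\mathbb{C}}$, the spherical geodesic joining them is the smaller arc of the great circle through $a$ and $b$. A domain $\Omega\subset\widehat{\mathbb{C}}$ is spherically convex if for any two points $a,b\in\Omega$ that are not antipodal the spherical geodesic joining $a$ and $b$ lies in $\Omega$. A meromorphic univalent (injective) map $f:\mathbb{D}\to\widehat{\mathbb{C}}$ is called spherically convex if $f(\mathbb{D})$ is a spherically convex domain. The group of (meromorphic) spherical isometries is $$\mathrm{Rot}(\widehat{\mathbb{C}})=\left\{e^{i\theta}\frac{z-a}{1+z\overline{a}}: a\in\mathbb{C},\theta\in\mathbb{R}\right\}\cup\left\{\frac{e^{i\theta}}{z}:\theta\in\mathbb{R}\right\};$$ "$f$ is a spherical isometry" means that $f$ is the restriction to $\mathbb{D}$ of an element of $\mathrm{Rot}(\widehat{\mathbb{C}})$. The spherical derivative is $f^{\sharp}(z)=\frac{|f'(z)|}{1+|f(z)|^2}$ (at a pole of $f$ defined by continuous extension). With $dA$ Lebesgue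 area measure and $r\mathbb{D}=\{|z|<r\}$, $$A_s f(r\mathbb{D})=\iint_{r\mathbb{D}}f^{\sharp}(z)^2\,dA(z),\qquad A_s(r\mathbb{D})=\iint_{r\mathbb{D}}\frac{dA(z)}{(1+|z|^2)^2}=\frac{\pi r^2}{1+r^2}.$$ *)

theory Defs
  imports "HOL-Complex_Analysis.Complex_Analysis"
begin

text \<open>The point at infinity is \<^term>\<open>None\<close>.\<close>

type_synonym riemann_sphere = "complex option"

abbreviation riemann_sphere_topology :: "riemann_sphere topology" where
  "riemann_sphere_topology \<equiv> Alexandroff_compactification euclidean"

definition sphere_domain :: "riemann_sphere set \<Rightarrow> bool" where
  "sphere_domain \<Omega> \<longleftrightarrow>
     \<Omega> \<noteq> {} \<and> openin riemann_sphere_topology \<Omega> \<and> connectedin riemann_sphere_topology \<Omega>"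

text \<open>
  Inverse stereographic projection onto the unit sphere of \<open>\<complex> \<times> \<real>\<close>. The metric
  \<open>|dz| / (1 + |z|^2)\<close> is half the pull-back of the metric of the unit sphere, so the two have
  the same great circles and the same antipodal pairs.
\<close>

fun to_unit_sphere :: "riemann_sphere \<Rightarrow> complex \<times> real" where
  "to_unit_sphere None = (0, 1)"
| "to_unit_sphere (Some z) =
     (2 * z / of_real (1 + (cmod z)\<^sup>2), ((cmod z)\<^sup>2 - 1) / (1 + (cmod z)\<^sup>2))"

definition antipodal :: "riemann_sphere \<Rightarrow> riemann_sphere \<Rightarrow> bool" where
  "antipodal a b \<longleftrightarrow> to_unit_sphere b = - to_unit_sphere a"

text \<open>
  For non-antipodal points, the smaller arc of the great circle through them is the central
  projection \<open>v / |v|\<close> of the chord joining them. If \<open>a = b\<close> it is that single point. For antipodal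
  points the chord meets the centre and the definition is not meaningful.
\<close>

definition spherical_geodesic :: "riemann_sphere \<Rightarrow> riemann_sphere \<Rightarrow> riemann_sphere set" where
  "spherical_geodesic a b =
     {p. to_unit_sphere p \<in> sgn ` closed_segment (to_unit_sphere a) (to_unit_sphere b)}"

definition spherically_convex_domain :: "riemann_sphere set \<Rightarrow> bool" where
  "spherically_convex_domain \<Omega> \<longleftrightarrow> sphere_domain \<Omega> \<and>
     (\<forall>a\<in>\<Omega>. \<forall>b\<in>\<Omega>. \<not> antipodal a b \<longrightarrow> spherical_geodesic a b \<subseteq> \<Omega>)"

text \<open>
  The complex-valued function underlying a sphere-valued one. The value 0 at infinity is the
  convention of \<^const>\<open>nicely_meromorphic_on\<close> for the value at a pole.
\<close>

definition complex_part :: "(complex \<Rightarrow> riemann_sphere) \<Rightarrow> complex \<Rightarrow> complex" where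
  "complex_part f z = (case f z of None \<Rightarrow> 0 | Some w \<Rightarrow> w)"

definition meromorphic_map_on :: "(complex \<Rightarrow> riemann_sphere) \<Rightarrow> complex set \<Rightarrow> bool" where
  "meromorphic_map_on f S \<longleftrightarrow> complex_part f nicely_meromorphic_on S \<and>
     (\<forall>z\<in>S. f z = None \<longleftrightarrow> is_pole (complex_part f) z)"

definition spherically_convex_map :: "(complex \<Rightarrow> riemann_sphere) \<Rightarrow> bool" where
  "spherically_convex_map f \<longleftrightarrow>
     meromorphic_map_on f (ball 0 1) \<and> inj_on f (ball 0 1) \<and>
     spherically_convex_domain (f ` ball 0 1)"

text \<open>\<^const>\<open>moebius\<close> extended to the sphere, for \<open>a d \<noteq> b c\<close>.\<close>

fun sphere_moebius ::
  "complex \<Rightarrow> complex \<Rightarrow> complex \<Rightarrow> complex \<Rightarrow> riemann_sphere \<Rightarrow> riemann_sphere" where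
  "sphere_moebius a b c d None = (if c = 0 then None else Some (a / c))"
| "sphere_moebius a b c d (Some z) =
     (if c * z + d = 0 then None else Some (moebius a b c d z))"

text \<open>The maps \<open>e\<^sup>i\<^sup>\<theta> (z - a) / (1 + z cnj a)\<close> and \<open>e\<^sup>i\<^sup>\<theta> / z\<close>.\<close>

definition Rot :: "(riemann_sphere \<Rightarrow> riemann_sphere) set" where
  "Rot = {sphere_moebius (cis \<theta>) (- (cis \<theta> * a)) (cnj a) 1 | a \<theta>. True}
       \<union> {sphere_moebius 0 (cis \<theta>) 1 0 | \<theta>. True}"

definition spherical_isometry_on_disc :: "(complex \<Rightarrow> riemann_sphere) \<Rightarrow> bool" where
  "spherical_isometry_on_disc f \<longleftrightarrow> (\<exists>T\<in>Rot. \<forall>z\<in>ball 0 1. f z = T (Some z))"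

definition spherical_deriv :: "(complex \<Rightarrow> riemann_sphere) \<Rightarrow> complex \<Rightarrow> real" where
  "spherical_deriv f z =
     (let q = (\<lambda>w. cmod (deriv (complex_part f) w) / (1 + (cmod (complex_part f w))\<^sup>2))
      in if f z = None then Lim (at z) q else q z)"

definition spherical_area_image :: "(complex \<Rightarrow> riemann_sphere) \<Rightarrow> real \<Rightarrow> real" where
  "spherical_area_image f r = (LINT z:ball 0 r|lborel. (spherical_deriv f z)\<^sup>2)"

definition spherical_area_disc :: "real \<Rightarrow> real" where
  "spherical_area_disc r = (LINT z:ball (0::complex) r|lborel. 1 / (1 + (cmod z)\<^sup>2)\<^sup>2)"

definition spherical_area_ratio :: "(complex \<Rightarrow> riemann_sphere) \<Rightarrow> real \<Rightarrow> real" where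
  "spherical_area_ratio f r = spherical_area_image f r / spherical_area_disc r"

end

theory Submission
  imports Defs
begin

text \<open>
Let \<open>S\<close> be the spherical area of the image of the disc of radius \<open>r\<close> and \<open>A = pi r\<^sup>2 / (1 + r\<^sup>2)\<close> the
spherical area of that disc, both as functions of \<open>x = ln r\<close>. In this coordinate the disc satisfies the
logistic equation \<open>A' = 2 A (1 - A / pi)\<close>. Two facts imply that \<open>S / A\<close> increases strictly.

First, \<open>S' \<ge> 2 S (1 - S / pi)\<close>. Since area is conformally invariant, \<open>S'\<close> is the energy of the image
curve of the circle of radius \<open>r\<close>, and by Stokes' theorem \<open>S\<close> is the area that the curve encloses
(\<open>image_area_has_derivative\<close>, \<open>image_area_eq_flux\<close>). The claim is then an isoperimetric inequality
between energy and enclosed area (\<open>spherical_energy_of_closed_curve\<close>). To prove it, the curve is lifted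
along the Hopf fibration to an antiperiodic curve in the unit sphere of \<open>\<complex>\<^sup>2\<close> that has constant speed
along the fibres, and Wirtinger's inequality is applied to the lift.

Second, \<open>S < A\<close> unless the map is an isometry. A spherically convex domain that is not the whole
sphere lies in a hemisphere (\<open>spherically_convex_in_hemisphere\<close>), and a univalent image of the disc is
not the whole sphere by Liouville's theorem (\<open>image_ne_sphere\<close>). A rotation of the sphere preserves the
spherical derivative, so the map may be replaced by a univalent holomorphic map \<open>g\<close> of the unit disc
into itself. Such a map does not increase hyperbolic area, and among the sets of given hyperbolic area
the centred disc has the largest spherical area (\<open>image_area_le_disc\<close>). Equality makes \<open>g\<close> a rotation
about 0, and then the original map is an isometry.

Together, the derivative of \<open>S / A\<close> is at least \<open>2 S (A - S) / (pi A)\<close>, which is positive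
(\<open>area_ratio_strict_mono\<close>).
\<close>


section \<open>Wirtinger's inequality for antiperiodic functions\<close>
text \<open>
The function \<open>v = k tan (k (t - c))\<close> solves the Riccati equation \<open>v' = k\<^sup>2 + v\<^sup>2\<close>, and hence
\<open>y'\<^sup>2 - k\<^sup>2 y\<^sup>2 = (y' + v y)\<^sup>2 - (v y\<^sup>2)'\<close>. Integration and dropping the square
leave the boundary values of \<open>v y\<^sup>2\<close>.
\<close>
lemma integral_square_deriv_ge_tan_boundary:
  fixes y y' :: "real \<Rightarrow> real"
  assumes "a \<le> b"
    and y: "\<And>t. t \<in> {a..b} \<Longrightarrow> (y has_real_derivative y' t) (at t within {a..b})"
    and y': "continuous_on {a..b} y'"
    and small: "\<And>t. t \<in> {a..b} \<Longrightarrow> \<bar>k * (t - c)\<bar> < pi / 2"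
  shows "k\<^sup>2 * integral {a..b} (\<lambda>t. (y t)\<^sup>2)
           + k * tan (k * (a - c)) * (y a)\<^sup>2 - k * tan (k * (b - c)) * (y b)\<^sup>2
         \<le> integral {a..b} (\<lambda>t. (y' t)\<^sup>2)"
proof -
  let ?\<theta> = "\<lambda>t. tan (k * (t - c))"
  define B where "B t = k * ?\<theta> t * (y t)\<^sup>2" for t
  have cos: "cos (k * (t - c)) \<noteq> 0" if "t \<in> {a..b}" for t
    using small[OF that] by (intro less_imp_neq[THEN not_sym] cos_gt_zero_pi) auto
  have cy: "continuous_on {a..b} y"
    using y by (meson DERIV_continuous_on)
  have ct: "continuous_on {a..b} ?\<theta>"
    using cos by (intro continuous_intros) auto
  have int: "(\<lambda>t. (y t)\<^sup>2) integrable_on {a..b}" "(\<lambda>t. (y' t)\<^sup>2) integrable_on {a..b}"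
      "(\<lambda>t. (y' t + k * ?\<theta> t * y t)\<^sup>2) integrable_on {a..b}"
    by (intro integrable_continuous_interval continuous_intros cy y' ct)+
  have "(B has_real_derivative
      (y' t + k * ?\<theta> t * y t)\<^sup>2 - ((y' t)\<^sup>2 - k\<^sup>2 * (y t)\<^sup>2)) (at t within {a..b})"
    if t: "t \<in> {a..b}" for t
  proof -
    have "inverse ((cos (k * (t - c)))\<^sup>2) = 1 + (?\<theta> t)\<^sup>2"
      using tan_sec[OF cos[OF t]] by (simp add: power_inverse)
    then show ?thesis
      unfolding B_def using cos[OF t]
      by (auto intro!: derivative_eq_intros y[OF t] simp: power2_eq_square algebra_simps)
  qed
  then have "((\<lambda>t. (y' t + k * ?\<theta> t * y t)\<^sup>2 - ((y' t)\<^sup>2 - k\<^sup>2 * (y t)\<^sup>2))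
      has_integral (B b - B a)) {a..b}"
    using \<open>a \<le> b\<close>
    by (intro fundamental_theorem_of_calculus) (auto simp: has_real_derivative_iff_has_vector_derivative)
  moreover have "((\<lambda>t. (y' t + k * ?\<theta> t * y t)\<^sup>2 - ((y' t)\<^sup>2 - k\<^sup>2 * (y t)\<^sup>2))
      has_integral (integral {a..b} (\<lambda>t. (y' t + k * ?\<theta> t * y t)\<^sup>2)
        - (integral {a..b} (\<lambda>t. (y' t)\<^sup>2) - k\<^sup>2 * integral {a..b} (\<lambda>t. (y t)\<^sup>2)))) {a..b}"
    using int by (intro has_integral_diff has_integral_mult_right) (auto simp: has_integral_integral)
  ultimately have "B b - B a = integral {a..b} (\<lambda>t. (y' t + k * ?\<theta> t * y t)\<^sup>2)
        - (integral {a..b} (\<lambda>t. (y' t)\<^sup>2) - k\<^sup>2 * integral {a..b} (\<lambda>t. (y t)\<^sup>2))"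
    by (rule has_integral_unique)
  moreover have "0 \<le> integral {a..b} (\<lambda>t. (y' t + k * ?\<theta> t * y t)\<^sup>2)"
    by (intro integral_nonneg int) auto
  ultimately show ?thesis unfolding B_def by linarith
qed

text \<open>
An antiperiodic function has a zero \<open>z\<close>. Its antiperiodic continuation vanishes at \<open>z\<close> and at
\<open>z + 2 pi\<close>, and so has the energy of a string of length \<open>2 pi\<close> with fixed ends, whose lowest
frequency is \<open>1/2\<close>. At frequency \<open>1/2\<close> the tangent of the previous lemma has its poles at the zeros,
so the estimate is made for every \<open>k < 1/2\<close> and the limit is taken at the end.
\<close>
lemma Wirtinger_antiperiodic:
  fixes y y' :: "real \<Rightarrow> real"
  assumes y: "\<And>t. t \<in> {-pi..pi} \<Longrightarrow> (y has_real_derivative y' t) (at t within {-pi..pi})"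
    and y': "continuous_on {-pi..pi} y'"
    and anti: "y pi = - y (-pi)"
  shows "integral {-pi..pi} (\<lambda>t. (y t)\<^sup>2) / 4 \<le> integral {-pi..pi} (\<lambda>t. (y' t)\<^sup>2)"
proof -
  have cy: "continuous_on {-pi..pi} y"
    using y by (meson DERIV_continuous_on)
  have "\<exists>z\<ge>-pi. z \<le> pi \<and> y z = 0"
  proof (cases "y (-pi) \<le> 0")
    case True
    then show ?thesis using IVT'[of y "-pi" 0 pi] cy anti by auto
  next
    case False
    then show ?thesis using IVT2'[of y pi 0 "-pi"] cy anti by auto
  qed
  then obtain z where z: "-pi \<le> z" "z \<le> pi" "y z = 0" by blast
  let ?I = "integral {-pi..pi} (\<lambda>t. (y t)\<^sup>2)" and ?J = "integral {-pi..pi} (\<lambda>t. (y' t)\<^sup>2)"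
  have split: "integral {-pi..z} (\<lambda>t. (h t)\<^sup>2) + integral {z..pi} (\<lambda>t. (h t)\<^sup>2)
      = integral {-pi..pi} (\<lambda>t. (h t)\<^sup>2)" if "continuous_on {-pi..pi} h" for h :: "real \<Rightarrow> real"
    using z that by (intro Henstock_Kurzweil_Integration.integral_combine
        integrable_continuous_interval continuous_intros) auto
  have le: "k\<^sup>2 * ?I \<le> ?J" if k: "0 < k" "k < 1 / 2" for k
  proof -
    have small: "\<bar>k * s\<bar> < pi / 2" if "\<bar>s\<bar> \<le> pi" for s
    proof -
      have "\<bar>k * s\<bar> \<le> k * pi" using k that by (simp add: abs_mult)
      also have "\<dots> < pi / 2" using k pi_gt_zero by (simp add: mult.commute)
      finally show ?thesis .
    qed
    \<comment> \<open>The tangents are centred half a string length away from the zero, at \<open>z - pi\<close> and at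
      \<open>z + pi\<close>; then the boundary terms at \<open>-pi\<close> and \<open>pi\<close> cancel by antiperiodicity.\<close>
    have "k\<^sup>2 * integral {-pi..z} (\<lambda>t. (y t)\<^sup>2)
           + k * tan (k * (-pi - (z - pi))) * (y (-pi))\<^sup>2 - k * tan (k * (z - (z - pi))) * (y z)\<^sup>2
         \<le> integral {-pi..z} (\<lambda>t. (y' t)\<^sup>2)"
      using z by (intro integral_square_deriv_ge_tan_boundary small)
        (auto intro: has_field_derivative_subset[OF y] continuous_on_subset[OF y'])
    moreover have "k\<^sup>2 * integral {z..pi} (\<lambda>t. (y t)\<^sup>2)
           + k * tan (k * (z - (z + pi))) * (y z)\<^sup>2 - k * tan (k * (pi - (z + pi))) * (y pi)\<^sup>2
         \<le> integral {z..pi} (\<lambda>t. (y' t)\<^sup>2)"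
      using z by (intro integral_square_deriv_ge_tan_boundary small)
        (auto intro: has_field_derivative_subset[OF y] continuous_on_subset[OF y'])
    ultimately have "k\<^sup>2 * (integral {-pi..z} (\<lambda>t. (y t)\<^sup>2) + integral {z..pi} (\<lambda>t. (y t)\<^sup>2))
        \<le> integral {-pi..z} (\<lambda>t. (y' t)\<^sup>2) + integral {z..pi} (\<lambda>t. (y' t)\<^sup>2)"
      using z(3) anti by (simp add: algebra_simps)
    then show ?thesis using split[OF cy] split[OF y'] by simp
  qed
  have "((\<lambda>k. k\<^sup>2 * ?I) \<longlongrightarrow> (1 / 2)\<^sup>2 * ?I) (at_left (1 / 2))"
    by (intro tendsto_intros)
  moreover have "\<forall>\<^sub>F k in at_left (1 / 2). k\<^sup>2 * ?I \<le> ?J"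
    using eventually_at_left_real[of 0 "1/2"] le by (auto elim!: eventually_mono)
  ultimately have "(1 / 2)\<^sup>2 * ?I \<le> ?J"
    by (rule tendsto_upperbound) simp
  then show ?thesis by (simp add: power2_eq_square)
qed

lemma Wirtinger_antiperiodic_complex:
  fixes Y Y' :: "real \<Rightarrow> complex"
  assumes Y: "\<And>t. t \<in> {-pi..pi} \<Longrightarrow> (Y has_vector_derivative Y' t) (at t within {-pi..pi})"
    and Y': "continuous_on {-pi..pi} Y'"
    and anti: "Y pi = - Y (-pi)"
  shows "integral {-pi..pi} (\<lambda>t. (cmod (Y t))\<^sup>2) / 4 \<le> integral {-pi..pi} (\<lambda>t. (cmod (Y' t))\<^sup>2)"
proof -
  have cY: "continuous_on {-pi..pi} Y"
    using Y by (rule continuous_on_vector_derivative)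
  have "((\<lambda>t. Re (Y t)) has_real_derivative Re (Y' t)) (at t within {-pi..pi})"
       "((\<lambda>t. Im (Y t)) has_real_derivative Im (Y' t)) (at t within {-pi..pi})"
    if "t \<in> {-pi..pi}" for t
    using Y[OF that]
    by (auto simp: has_vector_derivative_complex_iff)
  then have "integral {-pi..pi} (\<lambda>t. (Re (Y t))\<^sup>2) / 4 \<le> integral {-pi..pi} (\<lambda>t. (Re (Y' t))\<^sup>2)"
     "integral {-pi..pi} (\<lambda>t. (Im (Y t))\<^sup>2) / 4 \<le> integral {-pi..pi} (\<lambda>t. (Im (Y' t))\<^sup>2)"
    using anti by (intro Wirtinger_antiperiodic continuous_intros Y'; simp)+
  moreover have "integral {-pi..pi} (\<lambda>t. (cmod (h t))\<^sup>2)
     = integral {-pi..pi} (\<lambda>t. (Re (h t))\<^sup>2) + integral {-pi..pi} (\<lambda>t. (Im (h t))\<^sup>2)"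
    if "continuous_on {-pi..pi} h" for h
    unfolding cmod_power2 using that
    by (intro Henstock_Kurzweil_Integration.integral_add integrable_continuous_interval continuous_intros)
  ultimately show ?thesis using cY Y' by simp
qed

section \<open>The isoperimetric inequality for the spherical energy\<close>
text \<open>
The point \<open>(y, g y)\<close> of the unit sphere of \<open>\<complex>\<^sup>2\<close> lies above \<open>g\<close> in the Hopf fibration. If \<open>y\<close> moves
with velocity \<open>y u\<close>, where the real part of \<open>u\<close> keeps the point on the sphere, then the square of the
speed is the sum of a part along the fibre and a horizontal part, which is the square of the
spherical speed of \<open>g\<close>.
\<close>
lemma lift_speed_identity:
  fixes g g' :: complex and w :: real
  defines "N \<equiv> 1 + (cmod g)\<^sup>2"
  defines "u \<equiv> Complex (- Re (cnj g * g') / N) w"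
  assumes "cmod y = 1 / sqrt N"
  shows "(cmod (y * u))\<^sup>2 + (cmod (g' * y + g * (y * u)))\<^sup>2
     = (w + Im (cnj g * g') / N)\<^sup>2 + (cmod g')\<^sup>2 / N\<^sup>2"
proof -
  have N: "N > 0" unfolding N_def by (simp add: add_pos_nonneg)
  have y2: "(cmod y)\<^sup>2 = 1 / N" using assms(3) N by (simp add: power_divide)
  have "(cmod (g' * y + g * (y * u))) = cmod y * cmod (g' + g * u)"
    by (simp add: norm_mult[symmetric] algebra_simps)
  then have "(cmod (y * u))\<^sup>2 + (cmod (g' * y + g * (y * u)))\<^sup>2
      = ((cmod u)\<^sup>2 + (cmod (g' + g * u))\<^sup>2) / N"
    by (simp add: norm_mult power_mult_distrib y2 add_divide_distrib)
  also have "\<dots> = (w + Im (cnj g * g') / N)\<^sup>2 + (cmod g')\<^sup>2 / N\<^sup>2"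
  proof -
    obtain a b where g: "g = Complex a b" by (cases g)
    obtain c d where g': "g' = Complex c d" by (cases g')
    define p where "p = a * c + b * d"
    define q where "q = a * d - b * c"
    have N': "N = 1 + a\<^sup>2 + b\<^sup>2" unfolding N_def g by (simp add: cmod_power2)
    have pq: "p\<^sup>2 + q\<^sup>2 = (N - 1) * (c\<^sup>2 + d\<^sup>2)" unfolding p_def q_def N' by algebra
    have re: "Re (cnj g * g') = p" "Im (cnj g * g') = q" unfolding g g' p_def q_def by auto
    define P where "P = p / N"
    have u: "u = Complex (- P) w" unfolding u_def re P_def by simp
    have "(cmod u)\<^sup>2 = (p / N)\<^sup>2 + w\<^sup>2"
      unfolding u P_def[symmetric] by (simp add: cmod_power2)
    moreover have "(cmod (g' + g * u))\<^sup>2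
        = c\<^sup>2 + d\<^sup>2 + 2 * (- p * P + q * w) + (N - 1) * (P\<^sup>2 + w\<^sup>2)"
      unfolding u g g' N' p_def q_def cmod_power2 by (simp add: power2_eq_square) algebra
    then have "(cmod (g' + g * u))\<^sup>2
        = c\<^sup>2 + d\<^sup>2 + 2 * (- p * (p / N) + q * w) + (N - 1) * ((p / N)\<^sup>2 + w\<^sup>2)"
      unfolding P_def .
    ultimately have "(cmod u)\<^sup>2 + (cmod (g' + g * u))\<^sup>2
       = N * ((p / N)\<^sup>2 + w\<^sup>2) + (c\<^sup>2 + d\<^sup>2 + 2 * (- p * (p / N) + q * w))"
      by (simp add: left_diff_distrib)
    then have "((cmod u)\<^sup>2 + (cmod (g' + g * u))\<^sup>2) / N
       = (c\<^sup>2 + d\<^sup>2 + 2 * (- p * (p / N) + q * w)) / N + (p / N)\<^sup>2 + w\<^sup>2"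
      using N by (simp add: add_divide_distrib)
    also have "\<dots> = w\<^sup>2 + 2 * q * w / N + (c\<^sup>2 + d\<^sup>2) / N - (p / N)\<^sup>2"
      using N by (simp add: field_simps power2_eq_square)
    also have "(p / N)\<^sup>2 = (N - 1) * (c\<^sup>2 + d\<^sup>2) / N\<^sup>2 - (q / N)\<^sup>2"
      using pq[symmetric] by (simp add: power_divide add_divide_distrib)
    finally have "((cmod u)\<^sup>2 + (cmod (g' + g * u))\<^sup>2) / N
       = w\<^sup>2 + 2 * q * w / N + (c\<^sup>2 + d\<^sup>2) / N - ((N - 1) * (c\<^sup>2 + d\<^sup>2) / N\<^sup>2 - (q / N)\<^sup>2)" .
    also have "\<dots> = (w + q / N)\<^sup>2 + (c\<^sup>2 + d\<^sup>2) / N\<^sup>2"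
      using N by (simp add: field_simps power2_eq_square)
    finally show ?thesis unfolding re by (simp add: g' cmod_power2)
  qed
  finally show ?thesis .
qed


text \<open>
This is the isoperimetric inequality of the sphere with the length replaced by the energy. The number
\<open>S\<close> is the spherical area that the curve encloses, and \<open>2 S\<close> is the holonomy of the Hopf fibration
along the curve. Therefore the curve has a lift to the unit sphere of \<open>\<complex>\<^sup>2\<close> whose speed along the
fibres is the constant \<open>S / pi - 1 / 2\<close> and whose phase changes by \<open>- pi\<close> in total. The lift is
antiperiodic and has norm 1, and the inequality of Wirtinger says that its energy
\<open>2 pi (S / pi - 1 / 2)\<^sup>2 + E\<close> is at least \<open>pi / 2\<close>.
\<close>
lemma spherical_energy_of_closed_curve:
  fixes \<gamma> \<gamma>' :: "real \<Rightarrow> complex"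
  assumes \<gamma>: "\<And>t. t \<in> {-pi..pi} \<Longrightarrow> (\<gamma> has_vector_derivative \<gamma>' t) (at t within {-pi..pi})"
    and \<gamma>': "continuous_on {-pi..pi} \<gamma>'"
    and closed: "\<gamma> pi = \<gamma> (-pi)"
  defines "S \<equiv> integral {-pi..pi} (\<lambda>t. Im (cnj (\<gamma> t) * \<gamma>' t) / (1 + (cmod (\<gamma> t))\<^sup>2)) / 2"
  shows "2 * S * (1 - S / pi) \<le> integral {-pi..pi} (\<lambda>t. (cmod (\<gamma>' t))\<^sup>2 / (1 + (cmod (\<gamma> t))\<^sup>2)\<^sup>2)"
proof -
  define N where "N t = 1 + (cmod (\<gamma> t))\<^sup>2" for t
  define \<kappa> where "\<kappa> t = Im (cnj (\<gamma> t) * \<gamma>' t) / N t" for t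
  define c where "c = S / pi"
  define L where "L t = - ln (N t) / 2" for t
  define w where "w t = c - 1 / 2 - \<kappa> t" for t
  define \<theta> where "\<theta> t = integral {-pi..t} w" for t
  define Y where "Y t = exp (Complex (L t) (\<theta> t))" for t
  define u where "u t = Complex (- Re (cnj (\<gamma> t) * \<gamma>' t) / N t) (w t)" for t
  have N: "N t > 0" for t unfolding N_def by (simp add: add_pos_nonneg)
  have c\<gamma>: "continuous_on {-pi..pi} \<gamma>"
    using \<gamma> by (rule continuous_on_vector_derivative)
  have cN: "continuous_on {-pi..pi} N"
    unfolding N_def by (intro continuous_intros c\<gamma>)
  have c\<kappa>: "continuous_on {-pi..pi} \<kappa>"
    unfolding \<kappa>_def using N by (intro continuous_intros cN c\<gamma> \<gamma>') (auto simp: less_imp_neq[THEN not_sym])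
  have cw: "continuous_on {-pi..pi} w"
    unfolding w_def by (intro continuous_intros c\<kappa>)
  have cu: "continuous_on {-pi..pi} u"
    unfolding u_def Complex_eq using N
    by (intro continuous_intros cN c\<gamma> \<gamma>' cw) (auto simp: less_imp_neq[THEN not_sym])
  have d\<theta>: "(\<theta> has_real_derivative w t) (at t within {-pi..pi})" if "t \<in> {-pi..pi}" for t
    unfolding \<theta>_def has_real_derivative_iff_has_vector_derivative
    using integral_has_vector_derivative[OF cw that] .
  have dL: "(L has_real_derivative (- Re (cnj (\<gamma> t) * \<gamma>' t) / N t)) (at t within {-pi..pi})"
    if t: "t \<in> {-pi..pi}" for t
  proof -
    have r: "((\<lambda>t. Re (\<gamma> t)) has_real_derivative Re (\<gamma>' t)) (at t within {-pi..pi})"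
      and i: "((\<lambda>t. Im (\<gamma> t)) has_real_derivative Im (\<gamma>' t)) (at t within {-pi..pi})"
      using \<gamma>[OF t] by (auto simp: has_vector_derivative_complex_iff)
    have dN: "(N has_real_derivative 2 * Re (cnj (\<gamma> t) * \<gamma>' t)) (at t within {-pi..pi})"
      unfolding N_def cmod_power2 by (auto intro!: derivative_eq_intros r i \<gamma>[OF t])
    show ?thesis
      unfolding L_def using N[of t] by (auto intro!: derivative_eq_intros dN simp: field_simps)
  qed
  have dY: "(Y has_vector_derivative Y t * u t) (at t within {-pi..pi})" if t: "t \<in> {-pi..pi}" for t
  proof -
    have "((\<lambda>t. Complex (L t) (\<theta> t)) has_vector_derivative u t) (at t within {-pi..pi})"
      using dL[OF t] d\<theta>[OF t] unfolding u_def by (simp add: has_vector_derivative_complex_iff)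
    from field_vector_diff_chain_within[OF this, of exp "exp (Complex (L t) (\<theta> t))"]
    show ?thesis unfolding Y_def
      by (auto simp: o_def mult.commute intro: DERIV_exp[THEN has_field_derivative_at_within])
  qed
  have cY: "continuous_on {-pi..pi} Y"
    using dY by (rule continuous_on_vector_derivative)
  have normY: "cmod (Y t) = 1 / sqrt (N t)" for t
    unfolding Y_def L_def using N[of t]
    by (simp add: exp_minus ln_sqrt[symmetric] inverse_eq_divide)
  have S\<kappa>: "integral {-pi..pi} \<kappa> = 2 * S"
    unfolding S_def \<kappa>_def N_def by simp
  have "\<theta> pi = - pi"
  proof -
    have "\<theta> pi = integral {-pi..pi} (\<lambda>_. c - 1 / 2) - integral {-pi..pi} \<kappa>"
      unfolding \<theta>_def w_def by (intro integral_diff integrable_continuous_interval c\<kappa>) auto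
    then show ?thesis unfolding S\<kappa> by (simp add: c_def field_simps)
  qed
  moreover have "\<theta> (-pi) = 0" unfolding \<theta>_def by simp
  moreover have "L pi = L (-pi)" unfolding L_def N_def closed ..
  ultimately have anti: "Y pi = - Y (-pi)"
    unfolding Y_def by (simp add: exp_eq_polar cis.code complex_eq_iff)
  have "integral {-pi..pi} (\<lambda>t. (cmod (Y t))\<^sup>2) / 4 \<le> integral {-pi..pi} (\<lambda>t. (cmod (Y t * u t))\<^sup>2)"
    by (intro Wirtinger_antiperiodic_complex dY continuous_intros cY cu anti)
  moreover have "integral {-pi..pi} (\<lambda>t. (cmod (\<gamma> t * Y t))\<^sup>2) / 4
      \<le> integral {-pi..pi} (\<lambda>t. (cmod (\<gamma> t * (Y t * u t) + \<gamma>' t * Y t))\<^sup>2)"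
    using closed anti
    by (intro Wirtinger_antiperiodic_complex has_vector_derivative_mult \<gamma> dY continuous_intros cY cu \<gamma>' c\<gamma>) auto
  ultimately have "(integral {-pi..pi} (\<lambda>t. (cmod (Y t))\<^sup>2) + integral {-pi..pi} (\<lambda>t. (cmod (\<gamma> t * Y t))\<^sup>2)) / 4
     \<le> integral {-pi..pi} (\<lambda>t. (cmod (Y t * u t))\<^sup>2)
       + integral {-pi..pi} (\<lambda>t. (cmod (\<gamma> t * (Y t * u t) + \<gamma>' t * Y t))\<^sup>2)"
    by simp
  also have "integral {-pi..pi} (\<lambda>t. (cmod (Y t))\<^sup>2) + integral {-pi..pi} (\<lambda>t. (cmod (\<gamma> t * Y t))\<^sup>2)
     = integral {-pi..pi} (\<lambda>t. (cmod (Y t))\<^sup>2 + (cmod (\<gamma> t * Y t))\<^sup>2)"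
    by (intro integral_add[symmetric] integrable_continuous_interval continuous_intros cY c\<gamma>)
  also have "(\<lambda>t. (cmod (Y t))\<^sup>2 + (cmod (\<gamma> t * Y t))\<^sup>2) = (\<lambda>t. 1)"
  proof
    fix t
    have "(cmod (Y t))\<^sup>2 + (cmod (\<gamma> t * Y t))\<^sup>2 = N t * (cmod (Y t))\<^sup>2"
      unfolding N_def norm_mult by (simp add: algebra_simps power_mult_distrib)
    then show "(cmod (Y t))\<^sup>2 + (cmod (\<gamma> t * Y t))\<^sup>2 = 1"
      using N[of t] by (simp add: normY power_divide)
  qed
  also have "integral {-pi..pi} (\<lambda>t. (cmod (Y t * u t))\<^sup>2)
       + integral {-pi..pi} (\<lambda>t. (cmod (\<gamma> t * (Y t * u t) + \<gamma>' t * Y t))\<^sup>2)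
     = integral {-pi..pi} (\<lambda>t. (cmod (Y t * u t))\<^sup>2 + (cmod (\<gamma> t * (Y t * u t) + \<gamma>' t * Y t))\<^sup>2)"
    by (intro integral_add[symmetric] integrable_continuous_interval continuous_intros cY cu c\<gamma> \<gamma>')
  also have "(\<lambda>t. (cmod (Y t * u t))\<^sup>2 + (cmod (\<gamma> t * (Y t * u t) + \<gamma>' t * Y t))\<^sup>2)
     = (\<lambda>t. (c - 1 / 2)\<^sup>2 + (cmod (\<gamma>' t))\<^sup>2 / (N t)\<^sup>2)"
  proof
    fix t
    show "(cmod (Y t * u t))\<^sup>2 + (cmod (\<gamma> t * (Y t * u t) + \<gamma>' t * Y t))\<^sup>2
        = (c - 1 / 2)\<^sup>2 + (cmod (\<gamma>' t))\<^sup>2 / (N t)\<^sup>2"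
      using lift_speed_identity[of "Y t" "\<gamma> t" "\<gamma>' t" "w t"] normY[of t]
      by (simp add: u_def N_def w_def \<kappa>_def add.commute)
  qed
  also have "integral {-pi..pi} (\<lambda>t. (c - 1 / 2)\<^sup>2 + (cmod (\<gamma>' t))\<^sup>2 / (N t)\<^sup>2)
     = integral {-pi..pi} (\<lambda>t. (c - 1 / 2)\<^sup>2) + integral {-pi..pi} (\<lambda>t. (cmod (\<gamma>' t))\<^sup>2 / (N t)\<^sup>2)"
    using N by (intro integral_add integrable_continuous_interval continuous_intros \<gamma>' cN)
      (auto simp: less_imp_neq[THEN not_sym])
  finally have "pi / 2 - 2 * pi * (c - 1 / 2)\<^sup>2 \<le> integral {-pi..pi} (\<lambda>t. (cmod (\<gamma>' t))\<^sup>2 / (N t)\<^sup>2)"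
    by simp
  also have "pi / 2 - 2 * pi * (c - 1 / 2)\<^sup>2 = 2 * S * (1 - S / pi)"
    unfolding c_def by (simp add: power2_eq_square field_simps)
  finally show ?thesis unfolding N_def .
qed

section \<open>Change of variables under holomorphic maps\<close>
text \<open>
A linear map that permutes the coordinate axes takes boxes to boxes of the same content, and so it
takes gauge integrals to gauge integrals. This is used to identify \<open>\<complex>\<close> with \<open>real ^ 2\<close>, where the
theorem on change of variables lives, and with \<open>real \<times> real\<close>, where the theorem of Fubini lives.
\<close>
context
  fixes v :: "'a::euclidean_space \<Rightarrow> 'b::euclidean_space"
  assumes lin: "linear v" and bij: "bij_betw v Basis Basis"
begin

lemma inner_basis_bijection: "b \<in> Basis \<Longrightarrow> v x \<bullet> v b = x \<bullet> b"
proof -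
  assume b: "b \<in> Basis"
  have "v x = v (\<Sum>c\<in>Basis. (x \<bullet> c) *\<^sub>R c)" by (simp add: euclidean_representation)
  also have "\<dots> = (\<Sum>c\<in>Basis. (x \<bullet> c) *\<^sub>R v c)"
    using lin by (simp add: linear_sum linear_scale)
  finally have "v x \<bullet> v b = (\<Sum>c\<in>Basis. (x \<bullet> c) * (v c \<bullet> v b))"
    by (simp add: inner_sum_left)
  also have "\<dots> = (\<Sum>c\<in>Basis. (x \<bullet> c) * (if c = b then 1 else 0))"
  proof (intro sum.cong refl)
    fix c :: 'a assume c: "c \<in> Basis"
    have "v c \<in> Basis" "v b \<in> Basis" "v c = v b \<longleftrightarrow> c = b"
      using bij b c by (auto simp: bij_betw_def inj_on_def)
    then show "(x \<bullet> c) * (v c \<bullet> v b) = (x \<bullet> c) * (if c = b then 1 else 0)"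
      by (simp add: inner_Basis)
  qed
  also have "\<dots> = x \<bullet> b" using b by (simp add: if_distrib cong: if_cong)
  finally show ?thesis .
qed

lemma mem_cbox_basis_bijection: "v x \<in> cbox (v a) (v b) \<longleftrightarrow> x \<in> cbox a b"
proof -
  have "(\<forall>i\<in>(Basis::'b set). Q i) \<longleftrightarrow> (\<forall>b\<in>(Basis::'a set). Q (v b))" for Q
    using bij by (metis bij_betw_def image_iff)
  then show ?thesis by (simp add: mem_box inner_basis_bijection)
qed

lemma norm_basis_bijection: "norm (v x) = norm x"
proof -
  have "(\<Sum>c\<in>Basis. (v x \<bullet> c)\<^sup>2) = (\<Sum>b\<in>Basis. (v x \<bullet> v b)\<^sup>2)"
    using sum.reindex_bij_betw[OF bij, of "\<lambda>c. (v x \<bullet> c)\<^sup>2"] by simp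
  also have "\<dots> = (\<Sum>b\<in>Basis. (x \<bullet> b)\<^sup>2)" by (simp add: inner_basis_bijection)
  finally show ?thesis unfolding norm_eq_sqrt_inner
    by (subst (1 2) euclidean_inner) (simp add: power2_eq_square)
qed

lemma bij_basis_bijection: "bij v"
proof (rule bijI)
  show "inj v" using lin norm_basis_bijection
    by (metis linear_injective_0 norm_eq_zero)
  have "Basis = v ` (Basis :: 'a set)" using bij by (simp add: bij_betw_def)
  then have "span (range v) = UNIV" using span_Basis by (metis image_mono span_mono subset_UNIV top.extremum_unique)
  then show "surj v" using lin by (metis linear_subspace_image span_eq_iff subspace_UNIV)
qed

lemma cbox_image_basis_bijection: "v ` cbox a b = cbox (v a) (v b)"
proof -
  have "y \<in> v ` cbox a b" if "y \<in> cbox (v a) (v b)" for y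
    using that mem_cbox_basis_bijection bij_basis_bijection by (metis bij_pointE image_eqI)
  then show ?thesis using mem_cbox_basis_bijection by blast
qed

lemma content_image_basis_bijection: "measure lborel (v ` cbox a b) = measure lborel (cbox a b)"
proof -
  have "(\<Prod>c\<in>Basis. v b \<bullet> c - v a \<bullet> c) = (\<Prod>c\<in>Basis. b \<bullet> c - a \<bullet> c)"
    using prod.reindex_bij_betw[OF bij, of "\<lambda>c. v b \<bullet> c - v a \<bullet> c"]
    by (simp add: inner_basis_bijection)
  moreover have "cbox (v a) (v b) = {} \<longleftrightarrow> cbox a b = {}"
    using cbox_image_basis_bijection[of a b] by auto
  ultimately show ?thesis by (simp add: cbox_image_basis_bijection content_cbox_if)
qed

lemma has_integral_cbox_basis_bijection:
  fixes f :: "'b \<Rightarrow> 'c::real_normed_vector"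
  assumes "(f has_integral i) (cbox (v a) (v b))"
  shows "((\<lambda>x. f (v x)) has_integral i) (cbox a b)"
proof -
  define h where "h = inv v"
  have vh: "v (h y) = y" and hv: "h (v x) = x" for x y
    using bij_basis_bijection by (auto simp: h_def bij_is_inj surj_f_inv_f bij_is_surj)
  have h_box: "h ` cbox c d = cbox (h c) (h d)" for c d
  proof -
    have "cbox c d = v ` cbox (h c) (h d)" by (simp add: cbox_image_basis_bijection vh)
    then show ?thesis by (simp add: image_image hv)
  qed
  have "((\<lambda>x. f (v x)) has_integral (1 / 1) *\<^sub>R i) (h ` cbox (v a) (v b))"
  proof (rule has_integral_twiddle[where g = v and h = h and r = 1])
    show "continuous (at x) v" for x
      using lin by (simp add: linear_continuous_at linear_conv_bounded_linear)
    show "\<exists>w z. v ` cbox c d = cbox w z" for c d using cbox_image_basis_bijection by blast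
    show "\<exists>w z. h ` cbox c d = cbox w z" for c d using h_box by blast
  qed (use assms in \<open>auto simp: vh hv content_image_basis_bijection\<close>)
  then show ?thesis by (simp add: h_box hv)
qed

lemma has_integral_basis_bijection:
  fixes f :: "'b \<Rightarrow> 'c::banach"
  assumes "(f has_integral i) (v ` S)"
  shows "((\<lambda>x. f (v x)) has_integral i) S"
proof -
  let ?f = "\<lambda>y. if y \<in> v ` S then f y else 0"
  have restr: "(\<lambda>x. ?f (v x)) = (\<lambda>x. if x \<in> S then f (v x) else 0)"
    using bij_basis_bijection by (auto simp: bij_is_inj inj_image_mem_iff)
  have intble: "?f integrable_on cbox c d"
    and lim: "\<And>e. e > 0 \<Longrightarrow> \<exists>B>0. \<forall>c d. ball 0 B \<subseteq> cbox c d \<longrightarrow> norm (integral (cbox c d) ?f - i) < e" for c d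
    using assms unfolding has_integral_alt'[of f] by blast+
  have pull: "((\<lambda>x. ?f (v x)) has_integral integral (cbox (v a) (v b)) ?f) (cbox a b)" for a b
    using intble by (intro has_integral_cbox_basis_bijection) (simp add: has_integral_integral)
  have ball: "ball 0 B \<subseteq> cbox (v a) (v b)" if "ball 0 B \<subseteq> cbox a b" for a b B
  proof
    fix y :: 'b assume "y \<in> ball 0 B"
    moreover obtain x where "y = v x" using bij_basis_bijection by (metis bij_pointE)
    ultimately show "y \<in> cbox (v a) (v b)"
      using that norm_basis_bijection[of x] mem_cbox_basis_bijection[of x a b] by auto
  qed
  show ?thesis
    unfolding has_integral_alt'[of "\<lambda>x. f (v x)"] restr[symmetric]
  proof (intro conjI allI impI)
    show "(\<lambda>x. ?f (v x)) integrable_on cbox a b" for a b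
      using pull by (auto simp: integrable_on_def)
    fix e :: real assume "0 < e"
    then obtain B where "B > 0" "\<forall>c d. ball 0 B \<subseteq> cbox c d \<longrightarrow> norm (integral (cbox c d) ?f - i) < e"
      using lim by blast
    then show "\<exists>B>0. \<forall>a b. ball 0 B \<subseteq> cbox a b \<longrightarrow> norm (integral (cbox a b) (\<lambda>x. ?f (v x)) - i) < e"
      using ball integral_unique[OF pull] by metis
  qed
qed

end

lemma has_integral_basis_bijection_iff:
  fixes f :: "'b::euclidean_space \<Rightarrow> 'c::banach" and v :: "'a::euclidean_space \<Rightarrow> 'b"
  assumes lin: "linear v" and bij: "bij_betw v Basis Basis"
  shows "((\<lambda>x. f (v x)) has_integral i) S \<longleftrightarrow> (f has_integral i) (v ` S)"
proof
  assume "((\<lambda>x. f (v x)) has_integral i) S"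
  define h where "h = inv v"
  have vh: "v (h y) = y" and hv: "h (v x) = x" for x y
    using bij_basis_bijection[OF lin bij] by (auto simp: h_def bij_is_inj surj_f_inv_f bij_is_surj)
  have "linear h"
  proof (rule linearI)
    show "h (x + y) = h x + h y" for x y
      using hv[of "h x + h y"] lin by (simp add: linear_add vh)
    show "h (r *\<^sub>R x) = r *\<^sub>R h x" for r x
      using hv[of "r *\<^sub>R h x"] lin by (simp add: linear_scale vh)
  qed
  moreover have "bij_betw h Basis Basis"
  proof -
    have "v ` Basis = Basis" using bij by (simp add: bij_betw_def)
    then have "h ` Basis \<subseteq> Basis" by (metis hv image_subset_iff imageE subsetI)
    moreover have "v ` Basis \<subseteq> Basis" using \<open>v ` Basis = Basis\<close> by simp
    ultimately show ?thesis
      by (intro bij_betw_byWitness[where f' = v]) (auto simp: hv vh)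
  qed
  moreover have "((\<lambda>x. f (v x)) has_integral i) (h ` v ` S)"
    using \<open>((\<lambda>x. f (v x)) has_integral i) S\<close> by (simp add: image_image hv)
  ultimately have "((\<lambda>y. f (v (h y))) has_integral i) (v ` S)"
    by (rule has_integral_basis_bijection[of h "\<lambda>x. f (v x)"])
  then show "(f has_integral i) (v ` S)" by (simp add: vh)
qed (rule has_integral_basis_bijection[OF assms])

lemma absolutely_integrable_basis_bijection_iff:
  fixes f :: "'b::euclidean_space \<Rightarrow> 'c::euclidean_space" and v :: "'a::euclidean_space \<Rightarrow> 'b"
  assumes lin: "linear v" and bij: "bij_betw v Basis Basis"
  shows "(\<lambda>x. f (v x)) absolutely_integrable_on S \<longleftrightarrow> f absolutely_integrable_on v ` S"
    and "integral S (\<lambda>x. f (v x)) = integral (v ` S) f"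
proof -
  note f = has_integral_basis_bijection_iff[OF assms, of f _ S]
  note nf = has_integral_basis_bijection_iff[OF assms, of "\<lambda>y. norm (f y)" _ S]
  show "(\<lambda>x. f (v x)) absolutely_integrable_on S \<longleftrightarrow> f absolutely_integrable_on v ` S"
    unfolding absolutely_integrable_on_def integrable_on_def f nf ..
  show "integral S (\<lambda>x. f (v x)) = integral (v ` S) f"
    unfolding integral_def integrable_on_def f ..
qed

definition plane_of :: "complex \<Rightarrow> real ^ 2" where
  "plane_of z = vector [Re z, Im z]"

lemma plane_of_nth [simp]: "plane_of z $ 1 = Re z" "plane_of z $ 2 = Im z"
  by (simp_all add: plane_of_def)

lemma linear_plane_of: "linear plane_of"
  by (rule linearI) (simp_all add: vec_eq_iff forall_2)

lemma Basis_real_2: "(Basis :: (real ^ 2) set) = {axis 1 1, axis 2 1}"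
proof -
  show ?thesis unfolding Basis_vec_def UNIV_2 by auto
qed

lemma plane_of_Basis: "plane_of 1 = axis 1 1" "plane_of \<i> = axis 2 1"
  by (simp_all add: vec_eq_iff forall_2 axis_def)

lemma bij_betw_plane_of: "bij_betw plane_of Basis Basis"
proof -
  have "inj_on plane_of Basis"
    by (rule inj_onI) (metis plane_of_nth complex_eq_iff)
  then show ?thesis
    by (simp add: bij_betw_def Basis_complex_def Basis_real_2 plane_of_Basis insert_commute)
qed

text \<open>
The derivative of \<open>g\<close> is the multiplication by \<open>g' z\<close>, a real linear map of the plane with
determinant \<open>\<bar>g' z\<bar>\<^sup>2\<close>. The form of the conclusion, with an arbitrary number \<open>b\<close>, transfers
integrability and the value of the integral in both directions.
\<close>
theorem holomorphic_change_of_variables: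
  fixes g g' :: "complex \<Rightarrow> complex" and h :: "complex \<Rightarrow> real"
  assumes S: "S \<in> sets borel"
    and g: "\<And>z. z \<in> S \<Longrightarrow> (g has_field_derivative g' z) (at z within S)"
    and inj: "inj_on g S"
  shows "(\<lambda>z. (cmod (g' z))\<^sup>2 * h (g z)) absolutely_integrable_on S \<and>
           integral S (\<lambda>z. (cmod (g' z))\<^sup>2 * h (g z)) = b
     \<longleftrightarrow> h absolutely_integrable_on (g ` S) \<and> integral (g ` S) h = b"
proof -
  let ?v = plane_of
  define u :: "real ^ 2 \<Rightarrow> complex" where "u p = Complex (p $ 1) (p $ 2)" for p
  have uv [simp]: "u (?v z) = z" for z by (simp add: u_def)
  have vu [simp]: "?v (u p) = p" for p
    by (simp add: u_def vec_eq_iff forall_2)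
  have lin_u: "linear u"
    by (rule linearI) (simp_all add: u_def complex_eq_iff)
  have bl: "bounded_linear u" "bounded_linear ?v"
    using lin_u linear_plane_of by (simp_all add: linear_conv_bounded_linear)
  define G where "G p = ?v (g (u p))" for p
  define G' where "G' p = (\<lambda>k. ?v (g' (u p) * u k))" for p
  have vS: "?v ` S = u -` S"
  proof
    show "?v ` S \<subseteq> u -` S" by auto
    show "u -` S \<subseteq> ?v ` S" using vu by (metis image_eqI subsetI vimageD)
  qed
  have "u \<in> borel_measurable borel"
    using bl by (intro borel_measurable_continuous_onI linear_continuous_on)
  then have "?v ` S \<in> sets borel" unfolding vS using S by (metis measurable_sets_borel)
  then have leb: "?v ` S \<in> sets lebesgue" by (simp add: sets_completionI_sets)
  have der: "(G has_derivative G' p) (at p within ?v ` S)" if p: "p \<in> ?v ` S" for p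
  proof -
    obtain z where z: "z \<in> S" "p = ?v z" using p by blast
    have "(u has_derivative u) (at p within ?v ` S)"
      using bl(1) by (rule bounded_linear_imp_has_derivative)
    moreover have "(g has_derivative (*) (g' z)) (at (u p) within u ` ?v ` S)"
      using g[OF z(1)] z by (simp add: has_field_derivative_def image_image)
    ultimately have "((\<lambda>p. g (u p)) has_derivative (\<lambda>k. g' z * u k)) (at p within ?v ` S)"
      by (rule has_derivative_in_compose)
    from bounded_linear.has_derivative[OF bl(2) this]
    show ?thesis unfolding G_def[abs_def] G'_def z by simp
  qed
  have injG: "inj_on G (?v ` S)"
  proof (rule inj_onI)
    fix p q assume "p \<in> ?v ` S" "q \<in> ?v ` S" "G p = G q"
    then obtain z w where "p = ?v z" "q = ?v w" "z \<in> S" "w \<in> S" "?v (g z) = ?v (g w)"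
      by (auto simp: G_def)
    then show "p = q" using inj uv by (metis inj_onD)
  qed
  have det: "\<bar>det (matrix (G' p))\<bar> = (cmod (g' (u p)))\<^sup>2" for p
  proof -
    have "matrix (G' p) $ 1 $ 1 = Re (g' (u p))" "matrix (G' p) $ 2 $ 2 = Re (g' (u p))"
      "matrix (G' p) $ 1 $ 2 = - Im (g' (u p))" "matrix (G' p) $ 2 $ 1 = Im (g' (u p))"
      by (simp_all add: matrix_def G'_def u_def axis_def)
    then show ?thesis by (simp only: det_2 cmod_power2) (simp add: power2_eq_square)
  qed
  have GvS: "G ` ?v ` S = ?v ` g ` S" by (simp add: image_image G_def)
  let ?f = "\<lambda>p. vec (h (u p)) :: real ^ 1"
  have "(\<lambda>p. \<bar>det (matrix (G' p))\<bar> *\<^sub>R ?f (G p)) absolutely_integrable_on (?v ` S) \<and>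
           integral (?v ` S) (\<lambda>p. \<bar>det (matrix (G' p))\<bar> *\<^sub>R ?f (G p)) = vec b
     \<longleftrightarrow> ?f absolutely_integrable_on (G ` ?v ` S) \<and> integral (G ` ?v ` S) ?f = vec b"
    by (rule has_absolute_integral_change_of_variables[OF leb der injG])
  then have "(\<lambda>p. (cmod (g' (u p)))\<^sup>2 * h (g (u p))) absolutely_integrable_on (?v ` S) \<and>
           integral (?v ` S) (\<lambda>p. (cmod (g' (u p)))\<^sup>2 * h (g (u p))) = b
     \<longleftrightarrow> (\<lambda>p. h (u p)) absolutely_integrable_on (?v ` g ` S) \<and> integral (?v ` g ` S) (\<lambda>p. h (u p)) = b"
    unfolding det GvS by (simp add: absolutely_integrable_on_1_iff integral_on_1_eq G_def vec_eq_iff)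
  then show ?thesis
    using absolutely_integrable_basis_bijection_iff[OF linear_plane_of bij_betw_plane_of,
        where f = "\<lambda>p. (cmod (g' (u p)))\<^sup>2 * h (g (u p))" and S = S]
      absolutely_integrable_basis_bijection_iff[OF linear_plane_of bij_betw_plane_of,
        where f = "\<lambda>p. h (u p)" and S = "g ` S"]
    by simp
qed

section \<open>Stokes' theorem in logarithmic coordinates\<close>
lemma absolutely_integrable_continuous_compact:
  fixes s :: "'a::euclidean_space \<Rightarrow> real"
  assumes "compact S" "continuous_on S s"
  shows "s absolutely_integrable_on S"
proof -
  have "integrable lborel (\<lambda>x. indicator S x *\<^sub>R s x)"
    by (rule borel_integrable_compact[OF assms])
  then show ?thesis unfolding set_integrable_def
    by (rule integrable_completion[THEN iffD2, rotated]) (metis borel_measurable_integrable \<open>integrable lborel _\<close>)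
qed

definition re_im :: "complex \<Rightarrow> real \<times> real" where
  "re_im z = (Re z, Im z)"

lemma linear_re_im: "linear re_im"
  by (rule linearI) (simp_all add: re_im_def)

lemma bij_betw_re_im: "bij_betw re_im Basis Basis"
proof -
  have "inj_on re_im Basis"
    by (rule inj_onI) (simp add: re_im_def complex_eq_iff)
  moreover have "re_im ` Basis = Basis"
    by (simp add: Basis_complex_def Basis_prod_def re_im_def insert_commute)
  ultimately show ?thesis by (simp add: bij_betw_def)
qed

lemma integral_complex_cbox:
  fixes f :: "complex \<Rightarrow> real"
  assumes f: "continuous_on (cbox (Complex a c) (Complex b d)) f"
  shows "integral (cbox (Complex a c) (Complex b d)) f
       = integral {a..b} (\<lambda>x. integral {c..d} (\<lambda>y. f (Complex x y)))"
proof -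
  let ?F = "\<lambda>p. f (Complex (fst p) (snd p))"
  have img: "re_im ` cbox (Complex a c) (Complex b d) = cbox (a, c) (b, d)"
    using cbox_image_basis_bijection[OF linear_re_im bij_betw_re_im] by (simp add: re_im_def)
  have cont: "continuous_on (cbox (a, c) (b, d)) ?F"
    by (rule continuous_on_compose2[OF f])
      (auto simp: Complex_eq cbox_Pair_eq in_cbox_complex_iff intro!: continuous_intros)
  have "integral (cbox (Complex a c) (Complex b d)) (\<lambda>z. ?F (re_im z))
      = integral (cbox (a, c) (b, d)) ?F"
    unfolding absolutely_integrable_basis_bijection_iff(2)[OF linear_re_im bij_betw_re_im, of _ ?F] img ..
  also have "\<dots> = integral (cbox a b) (\<lambda>x. integral (cbox c d) (\<lambda>y. ?F (x, y)))"
    by (rule integral_prod_continuous[OF cont])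
  finally show ?thesis by (simp add: re_im_def)
qed

text \<open>
Polar coordinates with a logarithmic radius: the exponential function maps a box of height \<open>2 pi\<close>
onto the annulus, with Jacobian \<open>e\<^sup>2\<^sup>x\<close>. It is injective after the removal of the lower edge of the
box, which is a null set.
\<close>
lemma integral_annulus_log_coordinates:
  fixes s :: "complex \<Rightarrow> real"
  defines "A \<equiv> \<lambda>a b. {z. exp a \<le> cmod z \<and> cmod z \<le> exp b}"
  assumes s: "continuous_on (A a b) s"
  shows "integral (A a b) s
    = integral {a..b} (\<lambda>x. integral {-pi..pi} (\<lambda>y. exp (2 * x) * s (exp (Complex x y))))"
proof -
  define B where "B = cbox (Complex a (-pi)) (Complex b pi)"
  define S where "S = B \<inter> {w. - pi < Im w}"
  define f where "f w = (cmod (exp w))\<^sup>2 * s (exp w)" for w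
  have S: "S \<in> sets borel"
    unfolding S_def B_def by (intro sets.Int borel_closed borel_open open_halfspace_Im_gt closed_cbox)
  have memB: "w \<in> B \<longleftrightarrow> a \<le> Re w \<and> Re w \<le> b \<and> -pi \<le> Im w \<and> Im w \<le> pi" for w
    unfolding B_def by (auto simp: in_cbox_complex_iff)
  have expB: "exp w \<in> A a b" if "w \<in> B" for w
    using that unfolding A_def memB by simp
  have "exp ` S = A a b"
  proof
    show "exp ` S \<subseteq> A a b" using expB by (auto simp: S_def)
    show "A a b \<subseteq> exp ` S"
    proof
      fix z assume z: "z \<in> A a b"
      then have "cmod z > 0" unfolding A_def using exp_gt_zero[of a] by (auto intro: less_le_trans)
      then have "z \<noteq> 0" by auto
      have "a \<le> ln (cmod z)" using z \<open>cmod z > 0\<close> by (simp add: A_def ln_ge_iff)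
      moreover have "ln (cmod z) \<le> ln (exp b)" using z \<open>cmod z > 0\<close> by (subst ln_le_cancel_iff) (auto simp: A_def)
      ultimately have "Ln z \<in> S"
        using \<open>z \<noteq> 0\<close> mpi_less_Im_Ln[of z] Im_Ln_le_pi[of z] by (simp add: S_def memB)
      then show "z \<in> exp ` S" using \<open>z \<noteq> 0\<close> by (metis exp_Ln imageI)
    qed
  qed
  have inj: "inj_on exp S"
    by (rule inj_onI, rule exp_complex_eqI) (auto simp: S_def memB)
  have "compact (A a b)"
  proof -
    have "A a b = cball 0 (exp b) - ball 0 (exp a)" by (auto simp: A_def)
    then show ?thesis by (simp add: compact_diff)
  qed
  then have "s absolutely_integrable_on A a b"
    using s by (rule absolutely_integrable_continuous_compact)
  moreover have "(exp has_field_derivative exp w) (at w within S)" for w :: complex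
    by (rule DERIV_exp[THEN has_field_derivative_at_within])
  ultimately have "integral (A a b) s = integral S f"
    using holomorphic_change_of_variables[of S exp exp s "integral (A a b) s", OF S _ inj]
      \<open>exp ` S = A a b\<close>
    unfolding f_def by simp
  also have "\<dots> = integral B f"
  proof (rule integral_spike_set)
    have "negligible {w::complex. \<i> \<bullet> w = - pi}" by (rule negligible_hyperplane) simp
    moreover have "{x \<in> B - S. f x \<noteq> 0} \<subseteq> {w. \<i> \<bullet> w = - pi}"
      unfolding S_def by (auto simp: memB inner_complex_def)
    ultimately show "negligible {x \<in> B - S. f x \<noteq> 0}" by (rule negligible_subset)
    have "{x \<in> S - B. f x \<noteq> 0} = {}" by (auto simp: S_def)
    then show "negligible {x \<in> S - B. f x \<noteq> 0}" by (metis negligible_empty)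
  qed
  also have "\<dots> = integral {a..b} (\<lambda>x. integral {-pi..pi} (\<lambda>y. f (Complex x y)))"
    unfolding B_def
  proof (rule integral_complex_cbox)
    have "continuous_on B (\<lambda>w. s (exp w))"
      using expB by (intro continuous_on_compose2[OF s] continuous_intros) auto
    then show "continuous_on (cbox (Complex a (-pi)) (Complex b pi)) f"
      unfolding f_def B_def by (intro continuous_intros)
  qed
  finally show ?thesis by (simp add: f_def power2_eq_square mult_exp_exp)
qed

text \<open>
This is the theorem of Stokes on a period of the strip. For the function
\<open>q = cnj G * G' / (1 + \<bar>G\<bar>\<^sup>2)\<close> the Cauchy-Riemann equations give
\<open>\<partial>\<^sub>x Re q - \<partial>\<^sub>y Im q = 2 \<bar>G'\<bar>\<^sup>2 / (1 + \<bar>G\<bar>\<^sup>2)\<^sup>2\<close>, and the integral of \<open>\<partial>\<^sub>y Im q\<close> over a period is 0.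
\<close>
lemma flux_has_derivative:
  fixes G G' G'' :: "complex \<Rightarrow> complex"
  assumes G: "\<And>w. Re w < 0 \<Longrightarrow> (G has_field_derivative G' w) (at w)"
    and G': "\<And>w. Re w < 0 \<Longrightarrow> (G' has_field_derivative G'' w) (at w)"
    and G'': "continuous_on {w. Re w < 0} G''"
    and per: "\<And>x. G (Complex x pi) = G (Complex x (-pi))" "\<And>x. G' (Complex x pi) = G' (Complex x (-pi))"
    and x: "x < 0"
  shows "((\<lambda>x. integral {-pi..pi} (\<lambda>y. Re (cnj (G (Complex x y)) * G' (Complex x y))
              / (1 + (cmod (G (Complex x y)))\<^sup>2)))
     has_real_derivative
       integral {-pi..pi} (\<lambda>y. 2 * ((cmod (G' (Complex x y)))\<^sup>2 / (1 + (cmod (G (Complex x y)))\<^sup>2)\<^sup>2))) (at x)"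
proof -
  define N where "N w = 1 + (cmod (G w))\<^sup>2" for w
  define q where "q w = cnj (G w) * G' w" for w
  define r where "r w = cnj (G w) * G'' w" for w
  define dx where "dx w = ((cmod (G' w))\<^sup>2 + Re (r w)) / N w - 2 * (Re (q w))\<^sup>2 / (N w)\<^sup>2" for w
  define dy where "dy w = (Re (r w) - (cmod (G' w))\<^sup>2) / N w + 2 * (Im (q w))\<^sup>2 / (N w)\<^sup>2" for w
  have N: "N w > 0" for w unfolding N_def by (simp add: add_pos_nonneg)
  have N0: "N w \<noteq> 0" for w using N[of w] by simp
  have cont: "continuous_on {w. Re w < 0} G" "continuous_on {w. Re w < 0} G'"
    using G G' by (auto intro!: continuous_at_imp_continuous_on DERIV_isCont)
  have cdx: "continuous_on {w. Re w < 0} dx"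
    unfolding dx_def r_def q_def N_def by (intro continuous_intros cont G'') (use N0 N_def in auto)
  have cq: "continuous_on {w. Re w < 0} (\<lambda>w. Re (q w) / N w)"
    unfolding q_def N_def by (intro continuous_intros cont) (use N0 N_def in auto)
  have ce: "continuous_on {w. Re w < 0} (\<lambda>w. 2 * ((cmod (G' w))\<^sup>2 / (N w)\<^sup>2))"
    unfolding N_def by (intro continuous_intros cont) (use N0 N_def in auto)
  have cdy: "continuous_on {w. Re w < 0} dy"
    unfolding dy_def r_def q_def N_def by (intro continuous_intros cont G'') (use N0 N_def in auto)
  have int_y: "(\<lambda>y. h (Complex x y)) integrable_on {-pi..pi}"
    if "continuous_on {w. Re w < 0} h" "x < 0" for h :: "complex \<Rightarrow> real" and x
    using that by (intro integrable_continuous_interval continuous_on_compose2[OF that(1)])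
       (auto simp: Complex_eq intro!: continuous_intros)
  have line_x: "((\<lambda>x. h (Complex x y)) has_vector_derivative D) (at x)"
    if "(h has_field_derivative D) (at (Complex x y))" for h D x y
    using field_vector_diff_chain_at[of "\<lambda>x. Complex x y" 1 x h D] that
    by (simp add: o_def has_vector_derivative_complex_iff)
  have line_y: "((\<lambda>y. h (Complex x y)) has_vector_derivative \<i> * D) (at y)"
    if "(h has_field_derivative D) (at (Complex x y))" for h D x y
    using field_vector_diff_chain_at[of "\<lambda>y. Complex x y" \<i> y h D] that
    by (simp add: o_def has_vector_derivative_complex_iff)
  have Dx: "((\<lambda>x. Re (q (Complex x y)) / N (Complex x y)) has_real_derivative dx (Complex x y)) (at x)"
    if "x < 0" for x y
  proof -
    note d = line_x[OF G, of x y] line_x[OF G', of x y]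
    have "((\<lambda>x. Re (G (Complex x y))) has_real_derivative Re (G' (Complex x y))) (at x)"
      "((\<lambda>x. Im (G (Complex x y))) has_real_derivative Im (G' (Complex x y))) (at x)"
      "((\<lambda>x. Re (G' (Complex x y))) has_real_derivative Re (G'' (Complex x y))) (at x)"
      "((\<lambda>x. Im (G' (Complex x y))) has_real_derivative Im (G'' (Complex x y))) (at x)"
      using d that by (auto simp: has_vector_derivative_complex_iff)
    note [derivative_intros] = this
    have dN: "((\<lambda>x. N (Complex x y)) has_real_derivative 2 * Re (q (Complex x y))) (at x)"
      unfolding N_def cmod_power2 q_def by (auto intro!: derivative_eq_intros)
    have dq: "((\<lambda>x. Re (q (Complex x y))) has_real_derivative
        (cmod (G' (Complex x y)))\<^sup>2 + Re (r (Complex x y))) (at x)"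
      unfolding q_def r_def cmod_power2
      by (auto intro!: derivative_eq_intros simp: power2_eq_square)
    show ?thesis
      using DERIV_divide[OF dq dN N0]
      by (rule DERIV_cong) (use N0[of "Complex x y"] in \<open>simp add: dx_def field_simps power2_eq_square\<close>)
  qed
  have Dy: "((\<lambda>y. Im (q (Complex x y)) / N (Complex x y)) has_real_derivative dy (Complex x y)) (at y)"
    if "x < 0" for x y
  proof -
    note d = line_y[OF G, of x y] line_y[OF G', of x y]
    have "((\<lambda>y. Re (G (Complex x y))) has_real_derivative - Im (G' (Complex x y))) (at y)"
      "((\<lambda>y. Im (G (Complex x y))) has_real_derivative Re (G' (Complex x y))) (at y)"
      "((\<lambda>y. Re (G' (Complex x y))) has_real_derivative - Im (G'' (Complex x y))) (at y)"
      "((\<lambda>y. Im (G' (Complex x y))) has_real_derivative Re (G'' (Complex x y))) (at y)"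
      using d that by (auto simp: has_vector_derivative_complex_iff)
    note [derivative_intros] = this
    have dN: "((\<lambda>y. N (Complex x y)) has_real_derivative - 2 * Im (q (Complex x y))) (at y)"
      unfolding N_def cmod_power2 q_def by (auto intro!: derivative_eq_intros)
    have dq: "((\<lambda>y. Im (q (Complex x y))) has_real_derivative
        Re (r (Complex x y)) - (cmod (G' (Complex x y)))\<^sup>2) (at y)"
      unfolding q_def r_def cmod_power2
      by (auto intro!: derivative_eq_intros simp: power2_eq_square)
    show ?thesis
      using DERIV_divide[OF dq dN N0]
      by (rule DERIV_cong) (use N0[of "Complex x y"] in \<open>simp add: dy_def field_simps power2_eq_square\<close>)
  qed
  have split: "dx w = 2 * ((cmod (G' w))\<^sup>2 / (N w)\<^sup>2) + dy w" for w
  proof -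
    have "(Re (q w))\<^sup>2 + (Im (q w))\<^sup>2 = (N w - 1) * (cmod (G' w))\<^sup>2"
      unfolding cmod_power2[symmetric] q_def N_def by (simp add: norm_mult power_mult_distrib)
    then have "(Re (q w))\<^sup>2 = (N w - 1) * (cmod (G' w))\<^sup>2 - (Im (q w))\<^sup>2" by simp
    then have "(Re (q w))\<^sup>2 / (N w)\<^sup>2
        = (cmod (G' w))\<^sup>2 / N w - (cmod (G' w))\<^sup>2 / (N w)\<^sup>2 - (Im (q w))\<^sup>2 / (N w)\<^sup>2"
      using N0[of w] by (simp add: diff_divide_distrib left_diff_distrib power2_eq_square[of "N w"])
    then show ?thesis unfolding dx_def dy_def
      by (simp add: add_divide_distrib diff_divide_distrib)
  qed
  have "((\<lambda>x. integral (cbox (-pi) pi) (\<lambda>y. Re (q (Complex x y)) / N (Complex x y))) has_real_derivative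
      integral (cbox (-pi) pi) (\<lambda>y. dx (Complex x y))) (at x within {..<0})"
  proof (rule leibniz_rule_field_derivative)
    show "((\<lambda>x. Re (q (Complex x y)) / N (Complex x y)) has_real_derivative dx (Complex x y)) (at x within {..<0})"
      if "x \<in> {..<0}" for x y
      using Dx[of x y] that by (auto intro: has_field_derivative_at_within)
    show "(\<lambda>y. Re (q (Complex x y)) / N (Complex x y)) integrable_on cbox (-pi) pi" if "x \<in> {..<0}" for x
      using int_y[OF cq] that by auto
    have "continuous_on ({..<0} \<times> cbox (-pi) pi) (\<lambda>p. dx (Complex (fst p) (snd p)))"
      by (rule continuous_on_compose2[OF cdx]) (auto simp: Complex_eq intro!: continuous_intros)
    then show "continuous_on ({..<0} \<times> cbox (-pi) pi) (\<lambda>(x, y). dx (Complex x y))"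
      by (simp add: case_prod_beta)
  qed (use x in auto)
  moreover have "integral {-pi..pi} (\<lambda>y. dx (Complex x y))
     = integral {-pi..pi} (\<lambda>y. 2 * ((cmod (G' (Complex x y)))\<^sup>2 / (N (Complex x y))\<^sup>2))"
  proof -
    have "((\<lambda>y. dy (Complex x y)) has_integral
       Im (q (Complex x pi)) / N (Complex x pi) - Im (q (Complex x (-pi))) / N (Complex x (-pi))) {-pi..pi}"
      using Dy[OF x] by (intro fundamental_theorem_of_calculus)
        (auto simp: has_real_derivative_iff_has_vector_derivative intro: has_vector_derivative_at_within)
    then have "integral {-pi..pi} (\<lambda>y. dy (Complex x y)) = 0"
      by (simp add: q_def N_def per integral_unique)
    then show ?thesis
      unfolding split using int_y[OF ce x] int_y[OF cdy x] by (simp add: integral_add)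
  qed
  ultimately show ?thesis
    using x by (simp add: at_within_open[of x "{..<0}"] q_def N_def)
qed

section \<open>The growth of the spherical area\<close>
definition spherical_density :: "(complex \<Rightarrow> complex) \<Rightarrow> complex \<Rightarrow> real" where
  "spherical_density g z = (cmod (deriv g z))\<^sup>2 / (1 + (cmod (g z))\<^sup>2)\<^sup>2"

text \<open>
The spherical area of the image of a disc, counted with multiplicity. The closed disc is compact, so
that the continuity of the density is enough for the existence of the integral.
\<close>
definition image_area :: "(complex \<Rightarrow> complex) \<Rightarrow> real \<Rightarrow> real" where
  "image_area g r = integral (cball 0 r) (spherical_density g)"

lemma one_plus_norm_square_nonzero: "1 + (norm x)\<^sup>2 \<noteq> 0"
  using zero_le_power2[of "norm x"] by linarith

lemma continuous_on_spherical_density: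
  assumes "g holomorphic_on ball 0 1"
  shows "continuous_on (ball 0 1) (spherical_density g)"
proof -
  have "continuous_on (ball 0 1) g" "continuous_on (ball 0 1) (deriv g)"
    using assms by (auto intro!: holomorphic_on_imp_continuous_on holomorphic_deriv)
  then show ?thesis unfolding spherical_density_def
    using one_plus_norm_square_nonzero by (intro continuous_intros) auto
qed

lemma spherical_density_integrable:
  assumes "g holomorphic_on ball 0 1" "r < 1"
  shows "spherical_density g absolutely_integrable_on cball 0 r"
  using assms by (intro absolutely_integrable_continuous_compact
      continuous_on_subset[OF continuous_on_spherical_density]) auto

lemma spherical_density_nonneg: "spherical_density g z \<ge> 0"
  by (simp add: spherical_density_def)

lemma integral_annulus_spherical_density:
  assumes g: "g holomorphic_on ball 0 1" and "a \<le> b" "b < 0"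
  shows "image_area g (exp b) - image_area g (exp a)
      = integral {a..b} (\<lambda>x. integral {-pi..pi} (\<lambda>y. exp (2 * x) * spherical_density g (exp (Complex x y))))"
proof -
  let ?A = "{z::complex. exp a \<le> cmod z \<and> cmod z \<le> exp b}"
  have eb: "exp b < 1" "exp a \<le> exp b" using assms by auto
  have cont: "continuous_on ?A (spherical_density g)"
    using eb(1) by (intro continuous_on_subset[OF continuous_on_spherical_density[OF g]])
      (auto simp del: exp_less_one_iff)
  have "compact ?A"
  proof -
    have "?A = cball 0 (exp b) - ball 0 (exp a)" by auto
    then show ?thesis by (simp add: compact_diff)
  qed
  then have "spherical_density g integrable_on ?A"
    using cont absolutely_integrable_continuous_compact set_lebesgue_integral_eq_integral(1) by blast
  moreover have "spherical_density g integrable_on cball 0 (exp a)"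
    using spherical_density_integrable[OF g, of "exp a"] eb set_lebesgue_integral_eq_integral(1) by auto
  moreover have "negligible (cball 0 (exp a) \<inter> ?A)"
    by (rule negligible_subset[OF negligible_sphere[of 0 "exp a"]]) auto
  moreover have "cball 0 (exp a) \<union> ?A = cball 0 (exp b)" by (auto intro: order_trans[OF _ eb(2)])
  ultimately have "image_area g (exp b) = image_area g (exp a) + integral ?A (spherical_density g)"
    unfolding image_area_def using integral_Un[of "spherical_density g" "cball 0 (exp a)" ?A] by simp
  then show ?thesis using integral_annulus_log_coordinates[OF cont] by simp
qed

text \<open>
The area tends to 0 with the radius; this fixes the constant of integration in
\<open>image_area_eq_flux\<close> below.
\<close>
lemma image_area_le_linear:
  assumes g: "g holomorphic_on ball 0 1"
  obtains M where "M \<ge> 0" "\<And>r. 0 < r \<Longrightarrow> r \<le> 1 / 2 \<Longrightarrow> \<bar>image_area g r\<bar> \<le> M * r"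
proof -
  have "compact (spherical_density g ` cball 0 (1/2))"
    by (intro compact_continuous_image continuous_on_subset[OF continuous_on_spherical_density[OF g]]) auto
  then obtain K where K: "\<And>z. z \<in> cball 0 (1/2) \<Longrightarrow> \<bar>spherical_density g z\<bar> \<le> K"
    by (force dest: compact_imp_bounded simp: bounded_iff)
  have K0: "K \<ge> 0" using K[of 0] by simp
  have "\<bar>image_area g r\<bar> \<le> (K * measure lebesgue (cball (0::complex) 1)) * r" if r: "0 < r" "r \<le> 1 / 2" for r
  proof -
    have int: "spherical_density g integrable_on cball 0 r"
      using spherical_density_integrable[OF g, of r] r set_lebesgue_integral_eq_integral(1) by auto
    have "\<bar>image_area g r\<bar> = image_area g r"
      unfolding image_area_def by (intro abs_of_nonneg integral_nonneg int) (simp add: spherical_density_nonneg)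
    also have "\<dots> \<le> integral (cball 0 r) (\<lambda>z::complex. K)"
    proof -
      have "(\<lambda>z::complex. K) integrable_on cball 0 r" by (rule integrable_on_const) simp
      then show ?thesis unfolding image_area_def
        by (rule Henstock_Kurzweil_Integration.integral_le[OF int])
          (use r in \<open>auto intro!: abs_le_D1[OF K]\<close>)
    qed
    also have "\<dots> = K * measure lebesgue (cball (0::complex) r)"
      using integral_mult_right[of "cball 0 r" K "\<lambda>z::complex. 1"]
      by (simp only: mult_1_right lmeasure_integral[OF lmeasurable_cball])
    also have "measure lebesgue (cball (0::complex) r) = measure lebesgue (cball (0::complex) 1) * r\<^sup>2"
      using r by (simp add: content_cball power2_eq_square)
    also have "r\<^sup>2 \<le> r" using r by (simp add: power2_eq_square mult_left_le)
    finally show ?thesis using K0 by (simp add: mult_left_mono mult.assoc)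
  qed
  then show thesis using that[of "K * measure lebesgue (cball (0::complex) 1)"] K0 by simp
qed

text \<open>
In the coordinate \<open>w = x + i y\<close> with \<open>z = e\<^sup>w\<close> the circle of radius \<open>e\<^sup>x\<close> is the vertical segment over
\<open>x\<close>. Spherical area is conformally invariant, and therefore its derivative with respect to \<open>x\<close> is the
spherical energy of the image of this circle, parametrised by the angle.
\<close>
definition log_pullback :: "(complex \<Rightarrow> complex) \<Rightarrow> complex \<Rightarrow> complex" where
  "log_pullback g w = g (exp w)"

definition log_pullback_deriv :: "(complex \<Rightarrow> complex) \<Rightarrow> complex \<Rightarrow> complex" where
  "log_pullback_deriv g w = deriv g (exp w) * exp w"

text \<open>
The boundary integral that equals the enclosed spherical area by the theorem of Stokes.
\<close>
definition flux :: "(complex \<Rightarrow> complex) \<Rightarrow> real \<Rightarrow> real" where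
  "flux g x = integral {-pi..pi}
     (\<lambda>y. Re (cnj (log_pullback g (Complex x y)) * log_pullback_deriv g (Complex x y))
           / (1 + (cmod (log_pullback g (Complex x y)))\<^sup>2)) / 2"

definition energy :: "(complex \<Rightarrow> complex) \<Rightarrow> real \<Rightarrow> real" where
  "energy g x = integral {-pi..pi} (\<lambda>y. exp (2 * x) * spherical_density g (exp (Complex x y)))"

context
  fixes g :: "complex \<Rightarrow> complex"
  assumes g: "g holomorphic_on ball 0 1"
begin

private abbreviation "G \<equiv> log_pullback g"
private abbreviation "G' \<equiv> log_pullback_deriv g"

lemma log_pullback_periodic: "G (Complex x pi) = G (Complex x (-pi))" "G' (Complex x pi) = G' (Complex x (-pi))"
  unfolding log_pullback_def log_pullback_deriv_def by (simp_all add: exp_eq_polar cis.code)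

lemma log_pullback_has_derivative:
  assumes "Re w < 0" shows "(G has_field_derivative G' w) (at w)"
proof -
  have "(g has_field_derivative deriv g (exp w)) (at (exp w))"
    using g assms by (intro holomorphic_derivI[of _ "ball 0 1"]) auto
  from DERIV_chain2[OF this DERIV_exp] show ?thesis unfolding log_pullback_def[abs_def] log_pullback_deriv_def .
qed

lemma energy_density_log_pullback:
  "(cmod (G' (Complex x y)))\<^sup>2 / (1 + (cmod (G (Complex x y)))\<^sup>2)\<^sup>2
   = exp (2 * x) * spherical_density g (exp (Complex x y))"
  by (simp add: log_pullback_def log_pullback_deriv_def spherical_density_def norm_mult power_mult_distrib
      power2_eq_square[of "exp x"] mult_exp_exp)

lemma log_pullback_circle_has_derivative:
  assumes "x < 0"
  shows "((\<lambda>y. G (Complex x y)) has_vector_derivative \<i> * G' (Complex x y)) (at y)"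
  using field_vector_diff_chain_at[of "\<lambda>y. Complex x y" \<i> y G] log_pullback_has_derivative[of "Complex x y"] assms
  by (simp add: o_def has_vector_derivative_complex_iff)

lemma log_pullback_continuous_on_circle:
  assumes "x < 0"
  shows "continuous_on {-pi..pi} (\<lambda>y. G (Complex x y))" "continuous_on {-pi..pi} (\<lambda>y. G' (Complex x y))"
proof -
  have "continuous_on {-pi..pi} (\<lambda>y. h (exp (Complex x y)))" if "h holomorphic_on ball 0 1" for h
    using assms by (intro continuous_on_compose2[OF holomorphic_on_imp_continuous_on[OF that]])
      (auto simp: Complex_eq intro!: continuous_intros)
  from this[OF g] this[OF holomorphic_deriv[OF g open_ball]]
  show "continuous_on {-pi..pi} (\<lambda>y. G (Complex x y))" "continuous_on {-pi..pi} (\<lambda>y. G' (Complex x y))"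
    unfolding log_pullback_def log_pullback_deriv_def Complex_eq by (auto intro!: continuous_intros)
qed

lemma flux_has_derivative_energy:
  assumes "x < 0" shows "(flux g has_real_derivative energy g x) (at x)"
proof -
  define G'' where "G'' w = deriv (deriv g) (exp w) * exp w * exp w + deriv g (exp w) * exp w" for w
  have dg: "deriv g holomorphic_on ball 0 1" "deriv (deriv g) holomorphic_on ball 0 1"
    using g by (auto intro!: holomorphic_deriv)
  have "(G' has_field_derivative G'' w) (at w)" if "Re w < 0" for w
  proof -
    have "(deriv g has_field_derivative deriv (deriv g) (exp w)) (at (exp w))"
      using dg that by (intro holomorphic_derivI[of _ "ball 0 1"]) auto
    from DERIV_mult[OF DERIV_chain2[OF this DERIV_exp] DERIV_exp[of w]]
    show ?thesis unfolding log_pullback_deriv_def[abs_def] G''_def by (simp add: ac_simps)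
  qed
  moreover have "continuous_on {w. Re w < 0} G''"
    unfolding G''_def
    by (intro continuous_intros continuous_on_compose2[OF holomorphic_on_imp_continuous_on[OF dg(1)]]
        continuous_on_compose2[OF holomorphic_on_imp_continuous_on[OF dg(2)]]) auto
  ultimately have "((\<lambda>x. integral {-pi..pi} (\<lambda>y. Re (cnj (G (Complex x y)) * G' (Complex x y))
              / (1 + (cmod (G (Complex x y)))\<^sup>2)))
     has_real_derivative
       integral {-pi..pi} (\<lambda>y. 2 * ((cmod (G' (Complex x y)))\<^sup>2 / (1 + (cmod (G (Complex x y)))\<^sup>2)\<^sup>2))) (at x)"
    by (intro flux_has_derivative[of _ _ G''] log_pullback_has_derivative log_pullback_periodic assms) auto
  from DERIV_cdivide[OF this, of 2] show ?thesis
    unfolding flux_def[abs_def] energy_def energy_density_log_pullback by simp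
qed

text \<open>
Both sides have the derivative \<open>energy g\<close>, and both tend to 0 as the circle shrinks to its centre.
\<close>
lemma image_area_eq_flux:
  assumes "x < 0" shows "image_area g (exp x) = flux g x"
proof -
  have const: "image_area g (exp b) - flux g b = image_area g (exp a) - flux g a" if "a \<le> b" "b < 0" for a b
  proof -
    have "(energy g has_integral flux g b - flux g a) {a..b}"
      using that flux_has_derivative_energy
      by (intro fundamental_theorem_of_calculus)
        (auto simp: has_real_derivative_iff_has_vector_derivative intro: has_vector_derivative_at_within)
    then have "integral {a..b} (energy g) = flux g b - flux g a" by (rule integral_unique)
    then show ?thesis
      using integral_annulus_spherical_density[OF g that] unfolding energy_def[abs_def] by simp
  qed
  obtain M where M: "M \<ge> 0" "\<And>r. 0 < r \<Longrightarrow> r \<le> 1 / 2 \<Longrightarrow> \<bar>image_area g r\<bar> \<le> M * r"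
    using image_area_le_linear[OF g] by metis
  have "compact ((\<lambda>z. g z * deriv g z) ` cball 0 (1/2))"
    using g by (intro compact_continuous_image continuous_on_mult holomorphic_on_imp_continuous_on)
      (auto intro!: holomorphic_on_subset[OF g] holomorphic_on_subset[OF holomorphic_deriv[OF g]])
  then obtain K where K: "\<And>z. z \<in> cball 0 (1/2) \<Longrightarrow> cmod (g z * deriv g z) \<le> K"
    by (force dest: compact_imp_bounded simp: bounded_iff)
  have flux_le: "\<bar>flux g t\<bar> \<le> (K * pi) * exp t" if t: "exp t \<le> 1 / 2" for t
  proof -
    have "norm (integral (cbox (-pi) pi) (\<lambda>y. Re (cnj (G (Complex t y)) * G' (Complex t y))
              / (1 + (cmod (G (Complex t y)))\<^sup>2))) \<le> (K * exp t) * measure lborel (cbox (-pi) pi)"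
    proof (rule integrable_bound)
      have "0 \<le> K" by (rule order_trans[OF norm_ge_zero K[of 0]]) simp
      then show "0 \<le> K * exp t" by simp
      have "exp t < 1" using t by linarith
      then have "t < 0" by simp
      then show "(\<lambda>y. Re (cnj (G (Complex t y)) * G' (Complex t y))
              / (1 + (cmod (G (Complex t y)))\<^sup>2)) integrable_on cbox (-pi) pi"
        using one_plus_norm_square_nonzero \<open>t < 0\<close> unfolding cbox_interval
        by (intro integrable_continuous_interval continuous_intros log_pullback_continuous_on_circle) auto
      fix y :: real
      let ?w = "Complex t y"
      have "\<bar>Re (cnj (G ?w) * G' ?w)\<bar> \<le> cmod (cnj (G ?w) * G' ?w)" by (rule abs_Re_le_cmod)
      also have "\<dots> = cmod (g (exp ?w) * deriv g (exp ?w)) * exp t"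
        by (simp add: log_pullback_def log_pullback_deriv_def norm_mult)
      also have "\<dots> \<le> K * exp t" using t by (intro mult_right_mono K) auto
      finally have "\<bar>Re (cnj (G ?w) * G' ?w)\<bar> \<le> K * exp t" .
      moreover have "\<bar>Re (cnj (G ?w) * G' ?w)\<bar> / (1 + (cmod (G ?w))\<^sup>2) \<le> \<bar>Re (cnj (G ?w) * G' ?w)\<bar>"
        by (simp add: divide_le_eq mult_le_cancel_left1 add_pos_nonneg)
      ultimately show "norm (Re (cnj (G ?w) * G' ?w) / (1 + (cmod (G ?w))\<^sup>2)) \<le> K * exp t"
        by simp
    qed
    then show ?thesis unfolding flux_def by (simp add: field_simps)
  qed
  define c where "c = image_area g (exp x) - flux g x"
  have "\<forall>\<^sub>F t in at_bot. \<bar>c\<bar> \<le> (M + K * pi) * exp t"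
  proof -
    have "\<forall>\<^sub>F t::real in at_bot. t \<le> min x (ln (1/2))" by (rule eventually_le_at_bot)
    then show ?thesis
    proof (rule eventually_mono)
      fix t :: real assume t: "t \<le> min x (ln (1/2))"
      then have et: "exp t \<le> 1 / 2" by (subst ln_ge_iff[symmetric]) auto
      have "c = image_area g (exp t) - flux g t" using const[of t x] t assms by (simp add: c_def)
      then have "\<bar>c\<bar> \<le> \<bar>image_area g (exp t)\<bar> + \<bar>flux g t\<bar>" by simp
      also have "\<dots> \<le> M * exp t + (K * pi) * exp t"
        using et by (intro add_mono M flux_le) auto
      finally show "\<bar>c\<bar> \<le> (M + K * pi) * exp t" by (simp add: algebra_simps)
    qed
  qed
  moreover have "((\<lambda>t. (M + K * pi) * exp t) \<longlongrightarrow> (M + K * pi) * 0) at_bot"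
    by (intro tendsto_mult tendsto_const exp_at_bot)
  ultimately have "\<bar>c\<bar> \<le> (M + K * pi) * 0" by (intro tendsto_lowerbound) auto
  then show ?thesis by (simp add: c_def)
qed

text \<open>
The isoperimetric inequality for the image of the circle of radius \<open>e\<^sup>x\<close>. Since the energy is the
derivative of the area, it is a differential inequality; the disc itself gives equality.
\<close>
lemma isoperimetric_differential_inequality:
  assumes x: "x < 0"
  shows "2 * image_area g (exp x) * (1 - image_area g (exp x) / pi) \<le> energy g x"
proof -
  let ?\<gamma> = "\<lambda>y. G (Complex x y)" and ?\<gamma>' = "\<lambda>y. \<i> * G' (Complex x y)"
  have "continuous_on {-pi..pi} ?\<gamma>'"
    by (intro continuous_intros log_pullback_continuous_on_circle x)
  moreover have "integral {-pi..pi} (\<lambda>t. Im (cnj (?\<gamma> t) * ?\<gamma>' t) / (1 + (cmod (?\<gamma> t))\<^sup>2)) / 2 = flux g x"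
    unfolding flux_def by (simp add: algebra_simps)
  moreover have "integral {-pi..pi} (\<lambda>t. (cmod (?\<gamma>' t))\<^sup>2 / (1 + (cmod (?\<gamma> t))\<^sup>2)\<^sup>2) = energy g x"
    unfolding energy_def energy_density_log_pullback[symmetric] by (simp add: norm_mult)
  ultimately show ?thesis
    using spherical_energy_of_closed_curve[of ?\<gamma> ?\<gamma>'] log_pullback_circle_has_derivative[OF x] log_pullback_periodic
    by (simp add: image_area_eq_flux[OF x] has_vector_derivative_at_within)
qed

lemma image_area_has_derivative:
  assumes x: "x < 0"
  shows "((\<lambda>x. image_area g (exp x)) has_real_derivative energy g x) (at x)"
  using flux_has_derivative_energy[OF x]
  by (rule has_field_derivative_transform_within_open[where S = "{..<0}"])
    (use x image_area_eq_flux in auto)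

end

lemma image_area_id:
  assumes "0 < r" "r < 1" shows "image_area (\<lambda>z. z) r = pi * r\<^sup>2 / (1 + r\<^sup>2)"
proof -
  have "image_area (\<lambda>z. z) (exp (ln r)) = flux (\<lambda>z. z) (ln r)"
    using assms by (intro image_area_eq_flux) auto
  also have "\<dots> = integral {-pi..pi} (\<lambda>y::real. r\<^sup>2 / (1 + r\<^sup>2)) / 2"
  proof -
    have "Re (cnj w * w) = (cmod w)\<^sup>2" for w by (metis Re_complex_of_real complex_norm_square mult.commute)
    then show ?thesis using assms
      unfolding flux_def log_pullback_def log_pullback_deriv_def by simp
  qed
  finally have "image_area (\<lambda>z. z) r = 2 * pi * (r\<^sup>2 / (1 + r\<^sup>2)) / 2" using assms by simp
  also have "2 * pi * t / 2 = pi * t" for t :: real by simp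
  finally show ?thesis by simp
qed

section \<open>Univalent maps of the disc into itself\<close>
text \<open>
Automorphisms of the disc move \<open>z\<close> and \<open>f z\<close> to 0, where this is the Schwarz lemma.
\<close>
lemma Schwarz_Pick_derivative:
  assumes f: "f holomorphic_on ball 0 1" and f1: "\<And>z. cmod z < 1 \<Longrightarrow> cmod (f z) < 1"
    and z: "cmod z < 1"
  shows "cmod (deriv f z) * (1 - (cmod z)\<^sup>2) \<le> 1 - (cmod (f z))\<^sup>2"
proof -
  define b where "b = f z"
  have b: "cmod b < 1" using f1[OF z] by (simp add: b_def)
  define F where "F = (\<lambda>w. Moebius_function 0 b (f (Moebius_function 0 (-z) w)))"
  have M1: "Moebius_function 0 (-z) holomorphic_on ball 0 1" and Mb: "Moebius_function 0 b holomorphic_on ball 0 1"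
    using z b by (auto intro: Moebius_function_holomorphic)
  have M1_in: "cmod (Moebius_function 0 (-z) w) < 1" if "cmod w < 1" for w
    using Moebius_function_norm_lt_1[of "-z" w 0] z that by simp
  have Mb_in: "cmod (Moebius_function 0 b w) < 1" if "cmod w < 1" for w
    using Moebius_function_norm_lt_1[of b w 0] b that by simp
  have M10: "Moebius_function 0 (-z) 0 = z" by (simp add: Moebius_function_simple)
  have "F holomorphic_on ball 0 1"
    unfolding F_def
    by (intro holomorphic_on_compose_gen[OF _ Mb, unfolded o_def] holomorphic_on_compose_gen[OF M1 f, unfolded o_def])
      (use M1_in f1 in auto)
  moreover have "F 0 = 0"
    unfolding F_def M10 b_def[symmetric] by (simp add: Moebius_function_simple)
  moreover have "cmod (F w) < 1" if "cmod w < 1" for w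
    unfolding F_def by (intro Mb_in f1 M1_in that)
  ultimately have "cmod (deriv F 0) \<le> 1" by (intro Schwarz_Lemma(2)[where \<xi> = 0]) auto
  moreover have "deriv F 0 = deriv f z * of_real (1 - (cmod z)\<^sup>2) / of_real (1 - (cmod b)\<^sup>2)"
  proof (rule DERIV_imp_deriv)
    have b2: "1 - cnj b * b \<noteq> 0"
      using b by (metis abs_square_less_1 abs_norm_cancel complex_norm_square eq_iff_diff_eq_0 less_irrefl mult.commute norm_of_real of_real_eq_1_iff)
    have d1: "(Moebius_function 0 (-z) has_field_derivative (1 - cnj z * z)) (at 0)"
      unfolding Moebius_function_simple[abs_def] by (auto intro!: derivative_eq_intros)
    have d2: "(Moebius_function 0 b has_field_derivative 1 / (1 - cnj b * b)) (at b)"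
    proof -
      have "((\<lambda>w. (w - b) / (1 - cnj b * w)) has_field_derivative
          ((1 - 0) * (1 - cnj b * b) - (b - b) * (0 - cnj b * 1)) / ((1 - cnj b * b) * (1 - cnj b * b))) (at b)"
        by (intro DERIV_divide DERIV_diff DERIV_ident DERIV_const DERIV_cmult b2)
      then show ?thesis using b2 by (simp add: Moebius_function_simple[abs_def])
    qed
    have df: "(f has_field_derivative deriv f z) (at z)"
      using f z by (intro holomorphic_derivI[of _ "ball 0 1"]) auto
    have "(F has_field_derivative 1 / (1 - cnj b * b) * (deriv f z * (1 - cnj z * z))) (at 0)"
      unfolding F_def
      by (rule DERIV_chain2[where g = "\<lambda>w. f (Moebius_function 0 (-z) w)", OF _ DERIV_chain2[where g = "Moebius_function 0 (-z)", OF _ d1]])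
        (simp_all add: M10 d2 df flip: b_def)
    then show "(F has_field_derivative
        deriv f z * of_real (1 - (cmod z)\<^sup>2) / of_real (1 - (cmod b)\<^sup>2)) (at 0)"
      by (simp add: mult.commute complex_norm_square[symmetric])
  qed
  ultimately have "cmod (deriv f z) * \<bar>1 - (cmod z)\<^sup>2\<bar> / \<bar>1 - (cmod b)\<^sup>2\<bar> \<le> 1"
    by (simp only: norm_mult norm_divide norm_of_real)
  moreover have "0 < 1 - (cmod z)\<^sup>2" "0 < 1 - (cmod b)\<^sup>2"
    using z b by (auto simp: abs_square_less_1)
  ultimately show ?thesis by (simp add: b_def divide_le_eq)
qed

lemma integral_pos_cball:
  fixes f :: "complex \<Rightarrow> real"
  assumes f: "continuous_on (cball 0 r) f" and nn: "\<And>z. z \<in> cball 0 r \<Longrightarrow> 0 \<le> f z"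
    and p: "p \<in> ball 0 r" "f p > 0"
  shows "0 < integral (cball 0 r) f"
proof -
  have int: "f integrable_on cball 0 r"
    using absolutely_integrable_continuous_compact[OF compact_cball f] set_lebesgue_integral_eq_integral(1) by blast
  have "isCont f p"
    using f p by (intro continuous_on_interior[of "cball 0 r"]) auto
  then obtain d where d: "d > 0" "\<And>z. dist p z < d \<Longrightarrow> \<bar>f z - f p\<bar> < f p / 2"
    using p(2) unfolding continuous_at_eps_delta by (metis half_gt_zero dist_commute dist_real_def)
  obtain e where e: "e > 0" "cball p e \<subseteq> ball 0 r"
    using p(1) open_ball open_contains_cball by blast
  define h where "h = min e (d / 2)"
  have h: "h > 0" "cball p h \<subseteq> cball 0 r" "\<And>z. z \<in> cball p h \<Longrightarrow> f p / 2 \<le> f z"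
  proof -
    show "h > 0" using d e by (simp add: h_def)
    show "cball p h \<subseteq> cball 0 r"
      using e(2) by (auto simp: h_def)
    fix z assume "z \<in> cball p h"
    then have "dist p z < d" using d(1) by (auto simp: h_def)
    from d(2)[OF this] show "f p / 2 \<le> f z" by linarith
  qed
  have inth: "f integrable_on cball p h"
    using absolutely_integrable_continuous_compact[OF compact_cball continuous_on_subset[OF f h(2)]]
      set_lebesgue_integral_eq_integral(1) by blast
  have "0 < f p / 2 * measure lebesgue (cball p h)"
    using p(2) h(1) by (simp add: content_cball_pos)
  also have "\<dots> = integral (cball p h) (\<lambda>z. f p / 2)"
    using integral_mult_right[of "cball p h" "f p / 2" "\<lambda>z::complex. 1"]
    by (simp only: mult_1_right lmeasure_integral[OF lmeasurable_cball])
  also have "\<dots> \<le> integral (cball p h) f"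
    by (rule Henstock_Kurzweil_Integration.integral_le[OF integrable_on_const inth h(3)]) auto
  also have "\<dots> \<le> integral (cball 0 r) f"
    by (rule integral_subset_le[OF h(2) inth int]) (use nn in auto)
  finally show ?thesis .
qed

text \<open>
By the inequality of Schwarz and Pick the image of \<open>\<bar>z\<bar> < r\<close> has at most the hyperbolic area of
\<open>\<bar>z\<bar> < r\<close>. The quotient of the spherical by the hyperbolic density is a decreasing function of \<open>\<bar>w\<bar>\<close>,
so among all sets of at most this hyperbolic area the centred disc has the largest spherical area
(the bathtub principle). Injectivity makes the integrals over the disc areas of the image.

Equality forces \<open>\<bar>g z\<bar> \<le> r\<close> for \<open>\<bar>z\<bar> < r\<close> and \<open>\<bar>g' 0\<bar> = 1 - \<bar>g 0\<bar>\<^sup>2\<close>. The inequality of Schwarz and Pick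
for \<open>g (r z) / r\<close> is \<open>\<bar>g' 0\<bar> \<le> 1 - \<bar>g 0\<bar>\<^sup>2 / r\<^sup>2\<close>; hence \<open>g 0 = 0\<close>, and \<open>g\<close> is a rotation by the equality
case of the Schwarz lemma.
\<close>
theorem image_area_le_disc:
  assumes g: "g holomorphic_on ball 0 1" and inj: "inj_on g (ball 0 1)"
    and g1: "\<And>z. cmod z < 1 \<Longrightarrow> cmod (g z) < 1" and r: "0 < r" "r < 1"
  shows "image_area g r \<le> image_area (\<lambda>z. z) r"
    and "image_area g r = image_area (\<lambda>z. z) r \<Longrightarrow> \<exists>\<alpha>. cmod \<alpha> = 1 \<and> (\<forall>z. cmod z < 1 \<longrightarrow> g z = \<alpha> * z)"
proof -
  \<comment> \<open>The spherical density minus the multiple of the hyperbolic density that agrees with it on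
    \<open>\<bar>w\<bar> = r\<close>; in the unit disc it is nonnegative precisely for \<open>\<bar>w\<bar> \<le> r\<close>.\<close>
  define \<psi> where "\<psi> w = 1 / (1 + (cmod w)\<^sup>2)\<^sup>2 - ((1 - r\<^sup>2) / (1 + r\<^sup>2))\<^sup>2 / (1 - (cmod w)\<^sup>2)\<^sup>2" for w
  define k where "k = ((1 - r\<^sup>2) / (1 + r\<^sup>2))\<^sup>2"
  define H where "H z = (cmod (deriv g z))\<^sup>2 / (1 - (cmod (g z))\<^sup>2)\<^sup>2" for z
  define P where "P z = (cmod (deriv g z))\<^sup>2 * max 0 (\<psi> (g z))" for z
  \<comment> \<open>The sum of the two losses: in the inequality of Schwarz and Pick, and by replacing \<open>\<psi>\<close> by its
    positive part. The deficit of the area is at least the integral of \<open>d\<close>.\<close>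
  define d where "d z = k * (1 / (1 - (cmod z)\<^sup>2)\<^sup>2 - H z)
     + (cmod (deriv g z))\<^sup>2 * (max 0 (\<psi> (g z)) - \<psi> (g z))" for z
  have r2: "0 < r\<^sup>2" "r\<^sup>2 < 1" using r by (auto simp: abs_square_less_1)
  have k: "k > 0" unfolding k_def using r2 one_plus_norm_square_nonzero[of r] by simp
  have sub: "cball 0 r \<subseteq> ball (0::complex) 1" using r by auto
  have sq: "(cmod z)\<^sup>2 < 1" if "cmod z < 1" for z using that by (simp add: abs_square_less_1)
  have ne: "1 - (cmod z)\<^sup>2 \<noteq> 0" if "z \<in> ball 0 1" for z using sq[of z] that by auto
  have \<psi>_sgn: "0 \<le> \<psi> w \<longleftrightarrow> cmod w \<le> r" if "cmod w < 1" for w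
  proof -
    have pos: "0 < 1 - (cmod w)\<^sup>2" "0 < 1 + (cmod w)\<^sup>2" "0 < 1 + r\<^sup>2" "0 < 1 - r\<^sup>2"
      using sq[OF that] r2 by (auto simp: add_pos_nonneg)
    have "0 \<le> \<psi> w \<longleftrightarrow> ((1 - r\<^sup>2) / (1 + r\<^sup>2) / (1 - (cmod w)\<^sup>2))\<^sup>2 \<le> (1 / (1 + (cmod w)\<^sup>2))\<^sup>2"
      unfolding \<psi>_def by (simp add: power_divide power_mult_distrib)
    also have "\<dots> \<longleftrightarrow> (1 - r\<^sup>2) / (1 + r\<^sup>2) / (1 - (cmod w)\<^sup>2) \<le> 1 / (1 + (cmod w)\<^sup>2)"
      using pos by (intro abs_le_square_iff[symmetric, THEN trans]) auto
    also have "\<dots> \<longleftrightarrow> (1 - r\<^sup>2) * (1 + (cmod w)\<^sup>2) \<le> (1 + r\<^sup>2) * (1 - (cmod w)\<^sup>2)"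
      using pos by (simp add: divide_simps mult.commute)
    also have "\<dots> \<longleftrightarrow> (cmod w)\<^sup>2 \<le> r\<^sup>2" by (simp add: algebra_simps)
    also have "\<dots> \<longleftrightarrow> cmod w \<le> r" using r by (simp add: abs_le_square_iff[symmetric])
    finally show ?thesis .
  qed
  have cg: "continuous_on (ball 0 1) g" "continuous_on (ball 0 1) (deriv g)"
    using g by (auto intro!: holomorphic_on_imp_continuous_on holomorphic_deriv)
  have c\<psi>: "continuous_on (ball 0 1) \<psi>"
    unfolding \<psi>_def using one_plus_norm_square_nonzero ne by (intro continuous_intros) auto
  have c\<psi>g: "continuous_on (ball 0 1) (\<lambda>z. \<psi> (g z))"
    using g1 by (intro continuous_on_compose2[OF c\<psi> cg(1)]) auto
  have cH: "continuous_on (ball 0 1) H"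
    unfolding H_def using ne g1 by (intro continuous_intros cg) auto
  have cP: "continuous_on (ball 0 1) P" unfolding P_def by (intro continuous_intros cg c\<psi>g)
  have cd: "continuous_on (ball 0 1) d"
    unfolding d_def using ne by (intro continuous_intros cg cH c\<psi>g) auto
  have ch: "continuous_on (ball 0 1) (\<lambda>z. k * (1 / (1 - (cmod z)\<^sup>2)\<^sup>2))"
    using ne by (intro continuous_intros) auto
  have int: "h absolutely_integrable_on K" "h integrable_on K"
    if "continuous_on (ball 0 1) h" "compact K" "K \<subseteq> ball 0 1" for h :: "complex \<Rightarrow> real" and K
    using absolutely_integrable_continuous_compact[of K h] that continuous_on_subset
      set_lebesgue_integral_eq_integral(1) by blast+
  have H_le: "H z \<le> 1 / (1 - (cmod z)\<^sup>2)\<^sup>2" if "z \<in> ball 0 1" for z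
  proof -
    have z: "cmod z < 1" using that by simp
    have "(cmod (deriv g z) * (1 - (cmod z)\<^sup>2))\<^sup>2 \<le> (1 - (cmod (g z))\<^sup>2)\<^sup>2"
      using Schwarz_Pick_derivative[OF g g1 z] sq[OF z] by (intro power_mono) auto
    then show ?thesis
      using ne[OF that] sq[OF g1[OF z]] unfolding H_def by (simp add: divide_simps power_mult_distrib)
  qed
  have d_nn: "d z \<ge> 0" if "z \<in> cball 0 r" for z
    unfolding d_def using k H_le[of z] sub that by (intro add_nonneg_nonneg mult_nonneg_nonneg) auto
  have dens: "spherical_density g z = P z + k * (1 / (1 - (cmod z)\<^sup>2)\<^sup>2) - d z" for z
    unfolding d_def P_def H_def \<psi>_def spherical_density_def k_def by (simp add: algebra_simps)
  have K: "compact (g ` cball 0 r)" "g ` cball 0 r \<subseteq> ball 0 1"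
    using sub g1 by (auto intro!: compact_continuous_image continuous_on_subset[OF cg(1)])
  have c\<psi>0: "continuous_on (ball 0 1) (\<lambda>w. max 0 (\<psi> w))" by (intro continuous_intros c\<psi>)
  have "integral (cball 0 r) P = integral (g ` cball 0 r) (\<lambda>w. max 0 (\<psi> w))"
  proof -
    have "(g has_field_derivative deriv g z) (at z within cball 0 r)" if "z \<in> cball 0 r" for z
      by (rule has_field_derivative_at_within, rule holomorphic_derivI[OF g open_ball]) (use sub that in auto)
    then show ?thesis
      using holomorphic_change_of_variables[of "cball 0 r" g "deriv g" "\<lambda>w. max 0 (\<psi> w)"
          "integral (g ` cball 0 r) (\<lambda>w. max 0 (\<psi> w))"]
        inj_on_subset[OF inj sub] int(1)[OF c\<psi>0 K] unfolding P_def by simp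
  qed
  also have "\<dots> \<le> integral (g ` cball 0 r \<union> cball 0 r) (\<lambda>w. max 0 (\<psi> w))"
    using K sub by (intro integral_subset_le int c\<psi>0) auto
  also have "\<dots> = integral (cball 0 r) (\<lambda>w. max 0 (\<psi> w))"
  proof (rule integral_spike_set)
    have "{w \<in> (g ` cball 0 r \<union> cball 0 r) - cball 0 r. max 0 (\<psi> w) \<noteq> 0} = {}"
      using \<psi>_sgn K(2) by (force simp: max_def not_le)
    then show "negligible {w \<in> (g ` cball 0 r \<union> cball 0 r) - cball 0 r. max 0 (\<psi> w) \<noteq> 0}"
      by (metis negligible_empty)
    have "{w \<in> cball 0 r - (g ` cball 0 r \<union> cball 0 r). max 0 (\<psi> w) \<noteq> 0} = {}" by auto
    then show "negligible {w \<in> cball 0 r - (g ` cball 0 r \<union> cball 0 r). max 0 (\<psi> w) \<noteq> 0}"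
      by (metis negligible_empty)
  qed
  also have "\<dots> = integral (cball 0 r) \<psi>"
    using \<psi>_sgn r by (intro integral_cong) (auto simp: max_def)
  finally have P_le: "integral (cball 0 r) P \<le> integral (cball 0 r) \<psi>" .
  have c: "compact (cball (0::complex) r)" by simp
  note I = int(2)[OF _ c sub]
  have "image_area g r = integral (cball 0 r) (\<lambda>z. P z + k * (1 / (1 - (cmod z)\<^sup>2)\<^sup>2) - d z)"
    unfolding image_area_def dens ..
  also have "\<dots> = integral (cball 0 r) P + integral (cball 0 r) (\<lambda>z. k * (1 / (1 - (cmod z)\<^sup>2)\<^sup>2))
      - integral (cball 0 r) d"
    using I[OF cP] I[OF ch] I[OF cd]
    by (simp add: Henstock_Kurzweil_Integration.integral_diff Henstock_Kurzweil_Integration.integral_add integrable_add)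
  finally have 1: "image_area g r = \<dots>" .
  have "image_area (\<lambda>z. z) r = integral (cball 0 r) (\<lambda>z. \<psi> z + k * (1 / (1 - (cmod z)\<^sup>2)\<^sup>2))"
    unfolding image_area_def spherical_density_def \<psi>_def k_def by simp
  also have "\<dots> = integral (cball 0 r) \<psi> + integral (cball 0 r) (\<lambda>z. k * (1 / (1 - (cmod z)\<^sup>2)\<^sup>2))"
    by (rule Henstock_Kurzweil_Integration.integral_add[OF I[OF c\<psi>] I[OF ch]])
  finally have diff: "image_area g r \<le> image_area (\<lambda>z. z) r - integral (cball 0 r) d"
    using 1 P_le by simp
  have "0 \<le> integral (cball 0 r) d" by (rule integral_nonneg[OF I[OF cd] d_nn])
  then show "image_area g r \<le> image_area (\<lambda>z. z) r" using diff by simp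
  assume eq: "image_area g r = image_area (\<lambda>z. z) r"
  have d0: "d z = 0" if "z \<in> ball 0 r" for z
    using integral_pos_cball[OF continuous_on_subset[OF cd sub] d_nn that] d_nn[of z] diff eq that
    by force
  have "\<psi> (g z) \<ge> 0" if z: "z \<in> ball 0 r" for z
  proof -
    have z1: "z \<in> ball 0 1" using z r by auto
    have "deriv g z \<noteq> 0"
      using holomorphic_injective_imp_regular[OF g open_ball inj z1] .
    moreover have "k * (1 / (1 - (cmod z)\<^sup>2)\<^sup>2 - H z) \<ge> 0" using k H_le[OF z1] by simp
    moreover have "(cmod (deriv g z))\<^sup>2 * (max 0 (\<psi> (g z)) - \<psi> (g z)) \<ge> 0" by simp
    ultimately show ?thesis using d0[OF z] unfolding d_def
      by (smt (verit) mult_eq_0_iff norm_eq_zero power2_eq_square max_def)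
  qed
  then have "g ` ball 0 r \<subseteq> cball 0 r" using \<psi>_sgn g1 r by auto
  moreover have "open (g ` ball 0 r)"
    using r by (intro open_mapping_thm3 holomorphic_on_subset[OF g] inj_on_subset[OF inj]) auto
  ultimately have gr: "g ` ball 0 r \<subseteq> ball 0 r"
    by (metis interior_cball interior_maximal)
  have z0: "(0::complex) \<in> ball 0 1" "(0::complex) \<in> ball 0 r" using r by auto
  have "H 0 = 1"
  proof -
    have "k * (1 / (1 - (cmod 0)\<^sup>2)\<^sup>2 - H 0) \<ge> 0" using k H_le[OF z0(1)] by simp
    moreover have "(cmod (deriv g 0))\<^sup>2 * (max 0 (\<psi> (g 0)) - \<psi> (g 0)) \<ge> 0" by simp
    ultimately have "k * (1 / (1 - (cmod 0)\<^sup>2)\<^sup>2 - H 0) = 0"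
      using d0[OF z0(2)] unfolding d_def by linarith
    then show ?thesis using k by simp
  qed
  then have "(cmod (deriv g 0))\<^sup>2 = (1 - (cmod (g 0))\<^sup>2)\<^sup>2"
    using ne[of "g 0"] g1[of 0] unfolding H_def by simp
  then have dg0: "cmod (deriv g 0) = 1 - (cmod (g 0))\<^sup>2"
    using sq[of "g 0"] g1[of 0] by (simp add: power2_eq_iff_nonneg)
  define F where "F z = g (of_real r * z) / of_real r" for z
  have in_r: "of_real r * z \<in> ball 0 r" if "cmod z < 1" for z
    using that r by (simp add: norm_mult)
  have F_hol: "F holomorphic_on ball 0 1"
  proof -
    have "of_real r * z \<in> ball 0 1" if "cmod z < 1" for z
      using in_r[OF that] r by auto
    then show ?thesis
      unfolding F_def using r
      by (intro holomorphic_intros holomorphic_on_compose_gen[OF _ g, unfolded o_def]) auto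
  qed
  have "cmod (F z) < 1" if "cmod z < 1" for z
  proof -
    have "g (of_real r * z) \<in> ball 0 r" using gr in_r[OF that] by (meson image_subset_iff)
    then show ?thesis using r by (simp add: F_def norm_divide)
  qed
  moreover have F0: "F 0 = g 0 / of_real r" by (simp add: F_def)
  ultimately have "cmod (deriv F 0) \<le> 1 - (cmod (g 0) / r)\<^sup>2"
    using r Schwarz_Pick_derivative[OF F_hol, of 0] by (simp add: F0 norm_divide)
  moreover have "deriv F 0 = deriv g 0"
  proof (rule DERIV_imp_deriv)
    have "(g has_field_derivative deriv g 0) (at (of_real r * 0))"
      using g by (simp, intro holomorphic_derivI[of _ "ball 0 1"]) auto
    from DERIV_cdivide[OF DERIV_chain2[OF this DERIV_cmult_Id], of "of_real r"]
    show "(F has_field_derivative deriv g 0) (at 0)" unfolding F_def[abs_def] using r by simp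
  qed
  ultimately have "(cmod (g 0) / r)\<^sup>2 \<le> (cmod (g 0))\<^sup>2" using dg0 by simp
  then have "(cmod (g 0))\<^sup>2 * (1 - r\<^sup>2) \<le> 0" using r by (simp add: power_divide divide_simps algebra_simps)
  then have "g 0 = 0" using r2 by (simp add: mult_le_0_iff)
  moreover from this have "cmod (deriv g 0) = 1" using dg0 by simp
  ultimately show "\<exists>\<alpha>. cmod \<alpha> = 1 \<and> (\<forall>z. cmod z < 1 \<longrightarrow> g z = \<alpha> * z)"
    using Schwarz_Lemma(3)[OF g _ g1, of 0] by auto
qed

text \<open>
Let \<open>S\<close> and \<open>A\<close> be the areas for \<open>g\<close> and for the disc as functions of \<open>x = ln r\<close>. Then
\<open>A' = 2 A (1 - A / pi)\<close> and \<open>S' \<ge> 2 S (1 - S / pi)\<close>, so that the numerator of \<open>(S / A)'\<close> is at least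
\<open>2 S A (A - S) / pi\<close>. This is positive, because \<open>S < A\<close> unless \<open>g\<close> is a rotation.
\<close>
theorem area_ratio_strict_mono:
  assumes g: "g holomorphic_on ball 0 1" and inj: "inj_on g (ball 0 1)"
    and g1: "\<And>z. cmod z < 1 \<Longrightarrow> cmod (g z) < 1"
    and rot: "\<nexists>\<alpha>. cmod \<alpha> = 1 \<and> (\<forall>z. cmod z < 1 \<longrightarrow> g z = \<alpha> * z)"
  shows "strict_mono_on {0<..<1} (\<lambda>r. image_area g r / image_area (\<lambda>z. z) r)"
proof -
  define S where "S x = image_area g (exp x)" for x
  define A where "A x = pi * exp (2 * x) / (1 + exp (2 * x))" for x :: real
  have A_eq: "image_area (\<lambda>z. z) (exp x) = A x" if "x < 0" for x
    using image_area_id[of "exp x"] that by (simp add: A_def power2_eq_square mult_exp_exp)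
  have Apos: "A x > 0" for x unfolding A_def by (intro divide_pos_pos mult_pos_pos) (auto simp: add_pos_pos)
  have lt: "S x < A x" if "x < 0" for x
  proof -
    have "exp x > 0" "exp x < 1" using that by auto
    from image_area_le_disc[OF g inj g1 this] rot show ?thesis
      unfolding S_def A_eq[OF that, symmetric] by (metis order_le_less)
  qed
  have Spos: "S x > 0" if "x < 0" for x
  proof -
    have "spherical_density g 0 > 0"
      using holomorphic_injective_imp_regular[OF g open_ball inj, of 0]
      unfolding spherical_density_def by (simp add: one_plus_norm_square_nonzero)
    moreover have "cball 0 (exp x) \<subseteq> ball (0::complex) 1"
    proof -
      have "exp x < 1" using that by simp
      then show ?thesis by (auto intro: le_less_trans simp del: exp_less_one_iff)
    qed
    ultimately show ?thesis unfolding S_def image_area_def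
      by (intro integral_pos_cball[where p = 0] continuous_on_subset[OF continuous_on_spherical_density[OF g]]
          spherical_density_nonneg) auto
  qed
  have dA: "(A has_real_derivative 2 * A x * (1 - A x / pi)) (at x)" for x
  proof -
    define e where "e = exp (2 * x)"
    have e: "1 + e \<noteq> 0" using exp_gt_zero[of "2 * x"] by (simp add: e_def add_pos_pos less_imp_neq[THEN not_sym])
    have de: "((\<lambda>x. exp (2 * x)) has_real_derivative 2 * e) (at x)"
      unfolding e_def by (auto intro!: derivative_eq_intros)
    have "(A has_real_derivative (pi * (2 * e) * (1 + e) - pi * e * (2 * e)) / ((1 + e) * (1 + e))) (at x)"
      using DERIV_divide[OF DERIV_cmult[OF de, of pi] DERIV_add[OF DERIV_const[of 1] de]] e
      unfolding A_def[abs_def] by (simp add: e_def)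
    moreover have "pi * (2 * e) * (1 + e) - pi * e * (2 * e) = 2 * (pi * e)" by algebra
    moreover have m: "1 - A x / pi = 1 / (1 + e)"
      using e unfolding A_def e_def[symmetric] by (simp add: divide_simps)
    have "2 * A x * (1 - A x / pi) = 2 * (pi * e) / ((1 + e) * (1 + e))"
      unfolding m by (simp add: A_def e_def)
    ultimately show ?thesis by simp
  qed
  have mono: "S x / A x < S y / A y" if "x < y" "y < 0" for x y
  proof (rule DERIV_pos_imp_increasing[OF that(1)])
    fix t assume "x \<le> t" "t \<le> y"
    then have t: "t < 0" using that by simp
    let ?E = "energy g t"
    have dS: "(S has_real_derivative ?E) (at t)"
      unfolding S_def[abs_def] by (rule image_area_has_derivative[OF g t])
    have E: "2 * S t * (1 - S t / pi) \<le> ?E"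
      unfolding S_def by (rule isoperimetric_differential_inequality[OF g t])
    have "0 < 2 * S t * A t * (A t - S t) / pi"
      using Spos[OF t] Apos[of t] lt[OF t] by simp
    also have "\<dots> = 2 * S t * (1 - S t / pi) * A t - S t * (2 * A t * (1 - A t / pi))"
      by (simp add: field_simps)
    also have "\<dots> \<le> ?E * A t - S t * (2 * A t * (1 - A t / pi))"
      using E Apos[of t] by (intro diff_right_mono mult_right_mono) auto
    finally have "0 < (?E * A t - S t * (2 * A t * (1 - A t / pi))) / (A t * A t)"
      using Apos[of t] by simp
    moreover have "((\<lambda>t. S t / A t) has_real_derivative
        (?E * A t - S t * (2 * A t * (1 - A t / pi))) / (A t * A t)) (at t)"
      using DERIV_divide[OF dS dA] Apos[of t] by simp
    ultimately show "\<exists>D. ((\<lambda>t. S t / A t) has_real_derivative D) (at t) \<and> 0 < D" by blast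
  qed
  show ?thesis
  proof (rule strict_mono_onI)
    fix r s :: real assume "r \<in> {0<..<1}" "s \<in> {0<..<1}" "r < s"
    then show "image_area g r / image_area (\<lambda>z. z) r < image_area g s / image_area (\<lambda>z. z) s"
      using mono[of "ln r" "ln s"] A_eq[of "ln r"] A_eq[of "ln s"] by (simp add: S_def)
  qed
qed

section \<open>Spherically convex domains lie in hemispheres\<close>
lemma norm_to_unit_sphere [simp]: "norm (to_unit_sphere p) = 1"
proof (cases p)
  case (Some z)
  define m where "m = (cmod z)\<^sup>2"
  have m: "1 + m > 0" unfolding m_def by (simp add: add_pos_nonneg)
  have "(norm (to_unit_sphere p))\<^sup>2 = (cmod (2 * z / of_real (1 + m)))\<^sup>2 + ((m - 1) / (1 + m))\<^sup>2"
    by (simp add: Some norm_prod_def m_def power_divide)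
  also have "(cmod (2 * z / of_real (1 + m)))\<^sup>2 = 4 * m / (1 + m)\<^sup>2"
    unfolding norm_divide norm_mult norm_of_real power_divide power_mult_distrib by (simp add: m_def)
  also have "4 * m / (1 + m)\<^sup>2 + ((m - 1) / (1 + m))\<^sup>2 = (4 * m + (m - 1)\<^sup>2) / (1 + m)\<^sup>2"
    by (simp add: power_divide add_divide_distrib)
  also have "4 * m + (m - 1)\<^sup>2 = (1 + m)\<^sup>2" by (simp add: power2_eq_square algebra_simps)
  finally have "(norm (to_unit_sphere p))\<^sup>2 = 1\<^sup>2" using m by simp
  then show ?thesis by (rule power2_eq_imp_eq) simp_all
qed (simp add: norm_prod_def)

text \<open>
Stereographic projection from the north pole is a left and right inverse of \<open>to_unit_sphere\<close> away
from infinity.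
\<close>
lemma to_unit_sphere_stereographic:
  assumes "norm X = 1" "snd X \<noteq> 1"
  shows "to_unit_sphere (Some (fst X / of_real (1 - snd X))) = X"
proof -
  obtain x t where X: "X = (x, t)" by (cases X)
  define w where "w = x / of_real (1 - t)"
  have xt: "(cmod x)\<^sup>2 + t\<^sup>2 = 1" using assms(1) unfolding X norm_prod_def by simp
  have "t\<^sup>2 \<le> 1" using xt zero_le_power2[of "cmod x"] by linarith
  then have "t < 1" using assms(2) X abs_square_le_1[of t] by auto
  then have t: "1 - t > 0" by simp
  have "(cmod w)\<^sup>2 = (cmod x)\<^sup>2 / (1 - t)\<^sup>2"
    unfolding w_def norm_divide norm_of_real power_divide by simp
  also have "(cmod x)\<^sup>2 = (1 + t) * (1 - t)" using xt by (simp add: algebra_simps power2_eq_square)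
  finally have w2: "(cmod w)\<^sup>2 = (1 + t) / (1 - t)" using t by (simp add: power2_eq_square)
  then have 1: "1 + (cmod w)\<^sup>2 = 2 / (1 - t)" and 2: "(cmod w)\<^sup>2 - 1 = 2 * t / (1 - t)"
    unfolding w2 using t by (simp_all add: divide_simps)
  have "2 * w / of_real (1 + (cmod w)\<^sup>2) = x"
  proof -
    have "of_real (1 - t) \<noteq> (0::complex)" using t by (simp only: of_real_eq_0_iff)
    then have "2 * w / of_real (2 / (1 - t)) = x" unfolding w_def by (simp only: of_real_divide) simp
    then show ?thesis by (simp only: 1)
  qed
  moreover have "((cmod w)\<^sup>2 - 1) / (1 + (cmod w)\<^sup>2) = t"
    unfolding 1 2 using t by simp
  ultimately have "to_unit_sphere (Some w) = X" by (simp only: to_unit_sphere.simps X)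
  then show ?thesis by (simp only: w_def X fst_conv snd_conv)
qed

lemma stereographic_to_unit_sphere:
  "snd (to_unit_sphere (Some z)) \<noteq> 1"
  "fst (to_unit_sphere (Some z)) / of_real (1 - snd (to_unit_sphere (Some z))) = z"
proof -
  have "1 + (cmod z)\<^sup>2 \<noteq> 0" by (rule one_plus_norm_square_nonzero)
  then have *: "1 - snd (to_unit_sphere (Some z)) = 2 / (1 + (cmod z)\<^sup>2)"
    by (simp add: divide_simps)
  then show "snd (to_unit_sphere (Some z)) \<noteq> 1"
    using \<open>1 + (cmod z)\<^sup>2 \<noteq> 0\<close> by (metis diff_self divide_eq_0_iff zero_neq_numeral)
  have "of_real (1 + (cmod z)\<^sup>2) \<noteq> (0::complex)"
    using \<open>1 + (cmod z)\<^sup>2 \<noteq> 0\<close> of_real_eq_0_iff by blast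
  then show "fst (to_unit_sphere (Some z)) / of_real (1 - snd (to_unit_sphere (Some z))) = z"
    unfolding * by (simp only: to_unit_sphere.simps fst_conv of_real_divide) simp
qed

lemma inj_to_unit_sphere: "to_unit_sphere p = to_unit_sphere q \<longleftrightarrow> p = q"
proof
  assume "to_unit_sphere p = to_unit_sphere q"
  then show "p = q"
    using stereographic_to_unit_sphere by (cases p; cases q) (metis snd_conv to_unit_sphere.simps(1))+
qed simp

lemma surj_to_unit_sphere:
  assumes "norm X = 1" obtains p where "to_unit_sphere p = X"
proof (cases "snd X = 1")
  case True
  then have "fst X = 0" using assms by (simp add: norm_prod_def)
  then have "to_unit_sphere None = X" using True by (simp add: prod_eq_iff)
  then show ?thesis by (rule that)
next
  case False
  then show ?thesis using to_unit_sphere_stereographic[OF assms] that by blast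
qed

declare to_unit_sphere.simps [simp del]

text \<open>
Let \<open>A\<close> and \<open>- A\<close> be the antipodal points and \<open>P\<close> any other point. The half great circle from \<open>A\<close> to
\<open>- A\<close> through \<open>P\<close> leaves \<open>A\<close> through points \<open>sgn (A + e P)\<close>, which are in the open set for small \<open>e > 0\<close>.
Such a point and \<open>- A\<close> are not antipodal, and \<open>P\<close> lies on the geodesic that joins them.
\<close>
lemma geodesic_convex_antipodal_pair_imp_UNIV:
  assumes "open {w. Some w \<in> \<Omega>}"
    and geo: "\<And>a b. a \<in> \<Omega> \<Longrightarrow> b \<in> \<Omega> \<Longrightarrow> \<not> antipodal a b \<Longrightarrow> spherical_geodesic a b \<subseteq> \<Omega>"
    and z: "Some z \<in> \<Omega>" and b: "b \<in> \<Omega>" and zb: "antipodal (Some z) b"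
  shows "p \<in> \<Omega>"
proof (cases "p = Some z \<or> p = b")
  case False
  define A where "A = to_unit_sphere (Some z)"
  define P where "P = to_unit_sphere p"
  have nA: "norm A = 1" and nP: "norm P = 1" by (simp_all add: A_def P_def)
  have bA: "to_unit_sphere b = - A" using zb by (simp add: antipodal_def A_def)
  have PA: "P \<noteq> A" "P \<noteq> - A"
    using False by (metis A_def P_def bA inj_to_unit_sphere)+
  define X where "X e = A + e *\<^sub>R P" for e :: real
  have parallel: False if "e *\<^sub>R P = k *\<^sub>R A" "e > 0" for e k
  proof -
    have "e = \<bar>k\<bar>" using arg_cong[OF that(1), of norm] that(2) nA nP by simp
    then have "k = e \<or> k = - e" using that(2) by linarith
    then show False using that PA by (metis less_irrefl scaleR_cancel_left scaleR_minus_left scaleR_minus_right)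
  qed
  define w where "w e = fst (sgn (X e)) / of_real (1 - snd (sgn (X e)))" for e
  have X_lim: "((\<lambda>e. sgn (X e)) \<longlongrightarrow> A) (at_right 0)"
  proof -
    have "(X \<longlongrightarrow> A + 0 *\<^sub>R P) (at_right 0)" unfolding X_def by (intro tendsto_intros)
    then have "((\<lambda>e. sgn (X e)) \<longlongrightarrow> sgn A) (at_right 0)"
      using nA by (intro tendsto_sgn) auto
    then show ?thesis using nA by (simp add: sgn_div_norm)
  qed
  then have "((\<lambda>e. snd (sgn (X e))) \<longlongrightarrow> snd A) (at_right 0)" by (rule tendsto_snd)
  then have ev1: "\<forall>\<^sub>F e in at_right 0. snd (sgn (X e)) \<noteq> 1"
    using stereographic_to_unit_sphere(1)[of z] by (intro tendsto_imp_eventually_ne) (simp add: A_def)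
  have "of_real (1 - snd A) \<noteq> (0::complex)"
    unfolding of_real_eq_0_iff using stereographic_to_unit_sphere(1)[of z] by (simp add: A_def)
  then have "(w \<longlongrightarrow> fst A / of_real (1 - snd A)) (at_right 0)"
    unfolding w_def by (intro tendsto_intros X_lim)
  moreover have "fst A / of_real (1 - snd A) = z"
    unfolding A_def by (rule stereographic_to_unit_sphere)
  ultimately have "\<forall>\<^sub>F e in at_right 0. w e \<in> {w. Some w \<in> \<Omega>}"
    using assms(1) z by (intro topological_tendstoD) auto
  then have ev2: "\<forall>\<^sub>F e in at_right 0. Some (w e) \<in> \<Omega>" by simp
  have "\<forall>\<^sub>F e in at_right (0::real). e > 0 \<and> snd (sgn (X e)) \<noteq> 1 \<and> Some (w e) \<in> \<Omega>"
    by (intro eventually_conj ev1 ev2 eventually_at_right_less)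
  then have "\<exists>e>0. snd (sgn (X e)) \<noteq> 1 \<and> Some (w e) \<in> \<Omega>"
    by (rule eventually_happens'[OF trivial_limit_at_right_real])
  then obtain e where e: "e > 0" "snd (sgn (X e)) \<noteq> 1" "Some (w e) \<in> \<Omega>" by blast
  have X0: "X e \<noteq> 0"
    using parallel[of e "-1"] e(1) by (auto simp: X_def add_eq_0_iff)
  define N where "N = norm (X e)"
  have N: "N > 0" using X0 by (simp add: N_def)
  have NX: "N *\<^sub>R sgn (X e) = X e" using X0 by (simp add: N_def sgn_div_norm)
  have q: "to_unit_sphere (Some (w e)) = sgn (X e)"
    unfolding w_def using X0 e(2) by (intro to_unit_sphere_stereographic) (auto simp: norm_sgn)
  have "\<not> antipodal (Some (w e)) b"
  proof
    assume "antipodal (Some (w e)) b"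
    then have "A = sgn (X e)" by (simp add: antipodal_def bA q)
    then have "N *\<^sub>R A = A + e *\<^sub>R P" using NX by (simp add: X_def)
    then have "e *\<^sub>R P = (N - 1) *\<^sub>R A" by (simp add: algebra_simps)
    then show False using parallel e(1) by blast
  qed
  from geo[OF e(3) b this] have geo': "spherical_geodesic (Some (w e)) b \<subseteq> \<Omega>" .
  have "P \<in> sgn ` closed_segment (sgn (X e)) (- A)"
  proof
    show "P = sgn ((e / (N + 1)) *\<^sub>R P)"
      using e(1) N nP by (simp add: sgn_scaleR) (simp add: sgn_div_norm)
    have "(e / (N + 1)) *\<^sub>R P = (1 / (N + 1)) *\<^sub>R (X e - A)" by (simp add: X_def)
    also have "\<dots> = (1 - 1 / (N + 1)) *\<^sub>R sgn (X e) + (1 / (N + 1)) *\<^sub>R (- A)"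
    proof -
      have "1 - 1 / (N + 1) = (1 / (N + 1)) * N" using N by (simp add: field_simps)
      then have "(1 - 1 / (N + 1)) *\<^sub>R sgn (X e) = (1 / (N + 1)) *\<^sub>R X e"
        using NX by (metis scaleR_scaleR)
      then show ?thesis by (simp only: scaleR_diff_right scaleR_minus_right add_uminus_conv_diff)
    qed
    finally show "(e / (N + 1)) *\<^sub>R P \<in> closed_segment (sgn (X e)) (- A)"
      using N unfolding in_segment by (intro exI[of _ "1 / (N + 1)"]) auto
  qed
  then have "p \<in> spherical_geodesic (Some (w e)) b"
    by (simp add: spherical_geodesic_def q bA flip: P_def)
  then show ?thesis using geo' by blast
qed (use z b in auto)

lemma spherically_convex_no_antipodal_pair:
  assumes "spherically_convex_domain \<Omega>" "\<Omega> \<noteq> UNIV" "a \<in> \<Omega>" "b \<in> \<Omega>"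
  shows "\<not> antipodal a b"
proof
  assume ab: "antipodal a b"
  have geo: "\<And>a b. a \<in> \<Omega> \<Longrightarrow> b \<in> \<Omega> \<Longrightarrow> \<not> antipodal a b \<Longrightarrow> spherical_geodesic a b \<subseteq> \<Omega>"
    and "openin riemann_sphere_topology \<Omega>"
    using assms(1) by (auto simp: spherically_convex_domain_def sphere_domain_def)
  then have "open {w. Some w \<in> \<Omega>}"
    unfolding openin_Alexandroff_compactification
  proof (elim disjE exE conjE)
    fix C assume "closedin euclidean C" "\<Omega> = insert None (Some ` (topspace euclidean - C))"
    then have "{w. Some w \<in> \<Omega>} = - C" "closed C" by auto
    then show ?thesis by (simp add: open_Compl)
  next
    fix U assume "openin euclidean U" "\<Omega> = Some ` U"
    then have "{w. Some w \<in> \<Omega>} = U" "open U" by auto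
    then show ?thesis by simp
  qed
  note U = geodesic_convex_antipodal_pair_imp_UNIV[OF this geo]
  have "\<exists>z c. Some z \<in> \<Omega> \<and> c \<in> \<Omega> \<and> antipodal (Some z) c"
  \<comment> \<open>The previous lemma wants a finite point as \<open>A\<close>; if \<open>a\<close> is infinity then \<open>b\<close> is 0.\<close>
  proof (cases a)
    case None
    then have "to_unit_sphere b = (0, -1)" using ab by (simp add: antipodal_def to_unit_sphere.simps)
    then obtain z where "b = Some z" by (cases b) (auto simp: to_unit_sphere.simps)
    moreover have "antipodal b a" using ab by (simp add: antipodal_def)
    ultimately show ?thesis using assms by blast
  qed (use ab assms in auto)
  then have "p \<in> \<Omega>" for p using U by blast
  then show False using assms(2) by blast
qed

text \<open>
The cone over a spherically convex set without antipodal pairs is convex, because a segment between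
two points of the cone projects centrally to a geodesic. It does not contain 0, and a hyperplane that
separates 0 from the cone bounds a closed half-space that meets the sphere in a hemisphere.
\<close>
lemma spherically_convex_in_hemisphere:
  assumes conv: "spherically_convex_domain \<Omega>" and "\<Omega> \<noteq> UNIV"
  obtains e where "\<And>p. p \<in> \<Omega> \<Longrightarrow> 0 \<le> to_unit_sphere e \<bullet> to_unit_sphere p"
proof -
  define C where "C = {t *\<^sub>R to_unit_sphere p | t p. 0 < t \<and> p \<in> \<Omega>}"
  have "convex C"
    unfolding convex_alt
  proof (intro ballI allI impI)
    fix x y and u :: real assume x: "x \<in> C" and y: "y \<in> C" and u: "0 \<le> u \<and> u \<le> 1"
    obtain t p where tp: "x = t *\<^sub>R to_unit_sphere p" "0 < t" "p \<in> \<Omega>" using x by (auto simp: C_def)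
    obtain s q where sq: "y = s *\<^sub>R to_unit_sphere q" "0 < s" "q \<in> \<Omega>" using y by (auto simp: C_def)
    let ?P = "to_unit_sphere p" and ?Q = "to_unit_sphere q"
    define k where "k = (1 - u) * t + u * s"
    have k: "k > 0"
    proof (cases "u = 0")
      case False
      then have "u * s > 0" using u sq by simp
      moreover have "(1 - u) * t \<ge> 0" using u tp by simp
      ultimately show ?thesis by (simp add: k_def)
    qed (use tp in \<open>simp add: k_def\<close>)
    define v where "v = u * s / k"
    have v: "0 \<le> v" "v \<le> 1" using k u tp(2) sq(2) by (auto simp: v_def k_def)
    define m where "m = (1 - v) *\<^sub>R ?P + v *\<^sub>R ?Q"
    have kv: "k * v = u * s" "k * (1 - v) = (1 - u) * t"
      using k by (auto simp: v_def k_def right_diff_distrib)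
    have xy: "(1 - u) *\<^sub>R x + u *\<^sub>R y = k *\<^sub>R m"
      by (simp add: m_def tp sq scaleR_add_right kv)
    have na: "\<not> antipodal p q" using spherically_convex_no_antipodal_pair[OF assms tp(3) sq(3)] .
    have "m \<noteq> 0"
    proof
      assume "m = 0"
      then have eq: "v *\<^sub>R ?Q = - ((1 - v) *\<^sub>R ?P)"
        unfolding m_def by (simp only: add_eq_0_iff)
      have "norm (v *\<^sub>R ?Q) = norm ((1 - v) *\<^sub>R ?P)" unfolding eq by (rule norm_minus_cancel)
      then have "v = 1 / 2" using v by simp
      with eq have "(1 / 2) *\<^sub>R ?Q = (1 / 2) *\<^sub>R (- ?P)" by simp
      then have "?Q = - ?P" by (subst (asm) scaleR_cancel_left) simp
      then show False using na by (simp add: antipodal_def)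
    qed
    then obtain w where w: "to_unit_sphere w = sgn m"
      using surj_to_unit_sphere[of "sgn m"] by (auto simp: norm_sgn)
    have "m \<in> closed_segment ?P ?Q" unfolding in_segment m_def using v by blast
    then have "w \<in> spherical_geodesic p q" unfolding spherical_geodesic_def using w by simp
    then have "w \<in> \<Omega>" using conv tp(3) sq(3) na by (auto simp: spherically_convex_domain_def)
    moreover have "k *\<^sub>R m = (k * norm m) *\<^sub>R to_unit_sphere w"
      using \<open>m \<noteq> 0\<close> by (simp add: w sgn_div_norm)
    ultimately show "(1 - u) *\<^sub>R x + u *\<^sub>R y \<in> C"
      unfolding xy C_def using k \<open>m \<noteq> 0\<close> by force
  qed
  moreover have "0 \<notin> C"
    unfolding C_def by (auto simp: eq_commute[of 0]) (metis norm_to_unit_sphere norm_zero zero_neq_one)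
  ultimately obtain n where n: "n \<noteq> 0" "\<forall>x\<in>C. 0 \<le> n \<bullet> x"
    using separating_hyperplane_set_0 by metis
  obtain e where e: "to_unit_sphere e = sgn n"
    using surj_to_unit_sphere[of "sgn n"] n(1) by (auto simp: norm_sgn)
  show thesis
  proof (rule that)
    fix p assume "p \<in> \<Omega>"
    then have "1 *\<^sub>R to_unit_sphere p \<in> C" unfolding C_def by (metis (mono_tags, lifting) mem_Collect_eq zero_less_one)
    then show "0 \<le> to_unit_sphere e \<bullet> to_unit_sphere p"
      using n by (simp add: e sgn_div_norm)
  qed
qed

text \<open>
A rotation of the sphere is a Moebius map \<open>(\<alpha> w + \<beta>) / (- cnj \<beta> w + cnj \<alpha>)\<close>. The rotation that takes
the centre \<open>e\<close> of the hemisphere to 0 takes the hemisphere to the closed unit disc. The two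
inequalities say this without division, for finite points and for infinity.
\<close>
lemma unitary_coefficients_of_hemisphere:
  assumes "\<And>p. p \<in> \<Omega> \<Longrightarrow> 0 \<le> to_unit_sphere e \<bullet> to_unit_sphere p"
  obtains \<alpha> \<beta> :: complex where "\<alpha> \<noteq> 0 \<or> \<beta> \<noteq> 0"
    "\<And>w. Some w \<in> \<Omega> \<Longrightarrow> cmod (\<alpha> * w + \<beta>) \<le> cmod (cnj \<alpha> - cnj \<beta> * w)"
    "None \<in> \<Omega> \<Longrightarrow> cmod \<alpha> \<le> cmod \<beta>"
proof (cases e)
  case None
  have "cmod w \<ge> 1" if "Some w \<in> \<Omega>" for w
  proof -
    have "0 \<le> ((cmod w)\<^sup>2 - 1) / (1 + (cmod w)\<^sup>2)" using assms[OF that] by (simp add: None to_unit_sphere.simps)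
    moreover have "1 + (cmod w)\<^sup>2 > 0" by (simp add: add_pos_nonneg)
    ultimately have "1\<^sup>2 \<le> (cmod w)\<^sup>2" by (simp add: zero_le_divide_iff)
    then show ?thesis by (rule power2_le_imp_le) simp
  qed
  then show ?thesis using that[of 0 \<i>] by (simp add: norm_mult)
next
  case (Some a)
  define A where "A = 1 + (cmod a)\<^sup>2"
  have A: "A > 0" by (simp add: A_def add_pos_nonneg)
  have "cmod (w - a) \<le> cmod (1 + cnj a * w)" if "Some w \<in> \<Omega>" for w
  proof -
    define W where "W = 1 + (cmod w)\<^sup>2"
    have W: "W > 0" by (simp add: W_def add_pos_nonneg)
    have "0 \<le> (2 * a / of_real A) \<bullet> (2 * w / of_real W) + ((cmod a)\<^sup>2 - 1) / A * (((cmod w)\<^sup>2 - 1) / W)"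
      using assms[OF that] by (simp add: Some A_def W_def to_unit_sphere.simps)
    also have "(2 * a / of_real A) \<bullet> (2 * w / of_real W) = 4 * (a \<bullet> w) / (A * W)"
      by (simp add: inner_complex_def add_divide_distrib Re_divide_of_real Im_divide_of_real algebra_simps)
    finally have "0 \<le> (4 * (a \<bullet> w) + ((cmod a)\<^sup>2 - 1) * ((cmod w)\<^sup>2 - 1)) / (A * W)"
      by (simp add: add_divide_distrib)
    then have "0 \<le> 4 * (a \<bullet> w) + ((cmod a)\<^sup>2 - 1) * ((cmod w)\<^sup>2 - 1)"
      unfolding pos_le_divide_eq[OF mult_pos_pos[OF A W]] by simp
    also have "\<dots> = (cmod (1 + cnj a * w))\<^sup>2 - (cmod (w - a))\<^sup>2"
      unfolding cmod_power2 by (simp add: inner_complex_def power2_eq_square algebra_simps)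
    finally show ?thesis by (simp add: abs_le_square_iff[symmetric])
  qed
  moreover have "1 \<le> cmod a" if "None \<in> \<Omega>"
  proof -
    have "0 \<le> ((cmod a)\<^sup>2 - 1) / A" using assms[OF that] by (simp add: Some A_def to_unit_sphere.simps)
    then have "1\<^sup>2 \<le> (cmod a)\<^sup>2" using A by (simp add: zero_le_divide_iff)
    then show ?thesis by (rule power2_le_imp_le) simp
  qed
  ultimately show ?thesis using that[of 1 "- a"] by simp
qed

section \<open>Rotations of the sphere\<close>
lemma unitary_moebius_deriv:
  assumes c: "(c has_field_derivative d) (at z)" and nz: "C * c z + D \<noteq> 0"
  shows "((\<lambda>z. (A * c z + B) / (C * c z + D)) has_field_derivative
      (A * D - B * C) * d / (C * c z + D)\<^sup>2) (at z)"
proof -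
  have "((\<lambda>z. (A * c z + B) / (C * c z + D)) has_field_derivative
      (A * d * (C * c z + D) - (A * c z + B) * (C * d)) / ((C * c z + D) * (C * c z + D))) (at z)"
    using nz by (auto intro!: derivative_eq_intros c)
  moreover have "A * d * (C * c z + D) - (A * c z + B) * (C * d) = (A * D - B * C) * d" by algebra
  ultimately show ?thesis by (simp add: power2_eq_square)
qed

text \<open>
If the columns of the coefficient matrix are orthogonal and of equal length \<open>sqrt s\<close>, then
\<open>\<bar>A w + B\<bar>\<^sup>2 + \<bar>C w + D\<bar>\<^sup>2 = s (1 + \<bar>w\<bar>\<^sup>2)\<close>, and the determinant has modulus \<open>s\<close>. Scalar multiples of
unitary matrices are included so as to cover the elements of \<open>Rot\<close> as they are written.
\<close>
lemma unitary_moebius_isometry: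
  fixes A B C D w d :: complex
  assumes len: "(cmod A)\<^sup>2 + (cmod C)\<^sup>2 = s" "(cmod B)\<^sup>2 + (cmod D)\<^sup>2 = s" "s > 0"
    and orth: "A * cnj B + C * cnj D = 0" and nz: "C * w + D \<noteq> 0"
  shows "cmod ((A * D - B * C) * d / (C * w + D)\<^sup>2) / (1 + (cmod ((A * w + B) / (C * w + D)))\<^sup>2)
    = cmod d / (1 + (cmod w)\<^sup>2)"
proof -
  define n where "n = (cmod (C * w + D))\<^sup>2"
  have n: "n > 0" using nz by (simp add: n_def)
  obtain a1 a2 b1 b2 c1 c2 d1 d2 w1 w2 where
    co: "A = Complex a1 a2" "B = Complex b1 b2" "C = Complex c1 c2" "D = Complex d1 d2" "w = Complex w1 w2"
    by (metis complex.exhaust)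
  have o: "a1 * b1 + a2 * b2 + c1 * d1 + c2 * d2 = 0" "a2 * b1 - a1 * b2 + c2 * d1 - c1 * d2 = 0"
    using orth by (auto simp: co complex_eq_iff algebra_simps)
  have l: "a1\<^sup>2 + a2\<^sup>2 + c1\<^sup>2 + c2\<^sup>2 = s" "b1\<^sup>2 + b2\<^sup>2 + d1\<^sup>2 + d2\<^sup>2 = s"
    using len by (auto simp: co cmod_power2)
  have sum: "(cmod (A * w + B))\<^sup>2 + n = s * (1 + (cmod w)\<^sup>2)"
    unfolding n_def cmod_power2 co using o l by simp algebra
  have "(cmod (A * D - B * C))\<^sup>2 = s\<^sup>2"
    unfolding cmod_power2 co using o l by simp algebra
  then have det: "cmod (A * D - B * C) = s" using len(3) by (simp add: power2_eq_iff_nonneg)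
  have "1 + (cmod ((A * w + B) / (C * w + D)))\<^sup>2 = s * (1 + (cmod w)\<^sup>2) / n"
    using n unfolding norm_divide power_divide n_def[symmetric] sum[symmetric] by (simp add: field_simps)
  moreover have "cmod ((A * D - B * C) * d / (C * w + D)\<^sup>2) = s * cmod d / n"
    by (simp add: norm_divide norm_mult norm_power det n_def)
  ultimately show ?thesis using n len(3) by simp
qed

lemma spherical_deriv_at_nonpole:
  assumes "f z \<noteq> None" shows "(spherical_deriv f z)\<^sup>2 = spherical_density (complex_part f) z"
  using assms by (simp only: spherical_deriv_def Let_def if_False spherical_density_def power_divide)

lemma set_integral_ball_eq_integral_cball:
  fixes h :: "complex \<Rightarrow> real"
  assumes "continuous_on (cball 0 r) h"
  shows "(LINT z:ball 0 r|lborel. h z) = integral (cball 0 r) h"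
proof -
  have "set_integrable lborel (cball 0 r) h"
    unfolding set_integrable_def using assms by (intro borel_integrable_compact) auto
  then have "set_integrable lborel (ball 0 r) h"
    by (rule set_integrable_subset) auto
  then have "(LINT z:ball 0 r|lborel. h z) = integral (ball 0 r) h"
    by (rule set_borel_integral_eq_integral)
  also have "\<dots> = integral (cball 0 r) h"
  proof (rule integral_spike_set)
    show "negligible {z \<in> cball 0 r - ball 0 r. h z \<noteq> 0}"
      by (rule negligible_subset[OF negligible_sphere[of 0 r]]) auto
    show "negligible {z \<in> ball 0 r - cball 0 r. h z \<noteq> 0}"
      by (rule negligible_subset[OF negligible_empty]) auto
  qed
  finally show ?thesis .
qed

text \<open>
The exceptional points \<open>K\<close> are the poles of \<open>f\<close> in the applications; a finite set is null, so the
limit that defines \<open>spherical_deriv f\<close> at a pole need not be computed.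
\<close>
lemma spherical_area_image_eq:
  assumes g: "g holomorphic_on ball 0 1" and K: "finite K"
    and eq: "\<And>z. z \<in> ball 0 1 - K \<Longrightarrow> (spherical_deriv f z)\<^sup>2 = spherical_density g z"
    and r: "r < 1"
  shows "spherical_area_image f r = image_area g r"
proof -
  have "spherical_area_image f r = (LINT z:ball 0 r|lborel. spherical_density g z)"
    unfolding spherical_area_image_def set_lebesgue_integral_def
  proof (rule integral_discrete_difference[where X = K])
    show "countable K" using K by (rule countable_finite)
    fix z assume "z \<notin> K"
    then show "indicat_real (ball 0 r) z *\<^sub>R (spherical_deriv f z)\<^sup>2
        = indicat_real (ball 0 r) z *\<^sub>R spherical_density g z"
      using eq[of z] r by (auto simp: indicator_def)
  qed auto
  also have "\<dots> = image_area g r"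
    unfolding image_area_def using r
    by (intro set_integral_ball_eq_integral_cball continuous_on_subset[OF continuous_on_spherical_density[OF g]]) auto
  finally show ?thesis .
qed

lemma spherical_area_disc_eq: "spherical_area_disc r = image_area (\<lambda>z. z) r"
proof -
  have "spherical_area_disc r = integral (cball 0 r) (\<lambda>z::complex. 1 / (1 + (cmod z)\<^sup>2)\<^sup>2)"
    unfolding spherical_area_disc_def using one_plus_norm_square_nonzero
    by (intro set_integral_ball_eq_integral_cball continuous_intros) auto
  then show ?thesis by (simp add: image_area_def spherical_density_def[abs_def])
qed

section \<open>Rotating a map into the unit disc\<close>
text \<open>
The composition of \<open>f\<close> with the rotation \<open>(\<alpha> w + \<beta>) / (- cnj \<beta> w + cnj \<alpha>)\<close>, as a complex function
for the case in which infinity is not a value of the composition.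
\<close>
definition rotated_part :: "(complex \<Rightarrow> riemann_sphere) \<Rightarrow> complex \<Rightarrow> complex \<Rightarrow> complex \<Rightarrow> complex" where
  "rotated_part f \<alpha> \<beta> z = (case f z of None \<Rightarrow> - (\<alpha> / cnj \<beta>)
     | Some w \<Rightarrow> (\<alpha> * w + \<beta>) / (- cnj \<beta> * w + cnj \<alpha>))"

context
  fixes f :: "complex \<Rightarrow> riemann_sphere"
  assumes mero: "meromorphic_map_on f (ball 0 1)" and inj: "inj_on f (ball 0 1)"
begin

lemma finite_poles: "finite {z \<in> ball 0 1. f z = None}"
proof -
  have "{z \<in> ball 0 1. f z = None} = f -` {None} \<inter> ball 0 1" by auto
  then show ?thesis using finite_vimage_IntI[OF _ inj, of "{None}"] by simp
qed

lemma pole_unique: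
  "x \<in> ball 0 1 \<Longrightarrow> y \<in> ball 0 1 \<Longrightarrow> f x = None \<Longrightarrow> f y = None \<Longrightarrow> x = y"
  by (rule inj_onD[OF inj]) simp_all

lemma complex_part_holomorphic: "complex_part f holomorphic_on ball 0 1 - {z \<in> ball 0 1. f z = None}"
proof -
  have "complex_part f analytic_on {z}" if "z \<in> ball 0 1" "f z \<noteq> None" for z
    using mero that unfolding meromorphic_map_on_def
    by (intro nicely_meromorphic_on_imp_analytic_at[of _ "ball 0 1"]) auto
  then have "complex_part f analytic_on ball 0 1 - {z \<in> ball 0 1. f z = None}"
    by (subst analytic_on_analytic_at) auto
  then show ?thesis by (rule analytic_imp_holomorphic)
qed

lemma open_nonpoles: "open (ball 0 1 - {z \<in> ball 0 1. f z = None})"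
  using finite_poles by (intro open_Diff open_ball finite_imp_closed)

lemma f_eq_Some: "f z \<noteq> None \<Longrightarrow> f z = Some (complex_part f z)"
  by (auto simp: complex_part_def)

text \<open>
If \<open>f\<close> were onto the sphere, the inverse of its finite part would be a bounded entire function and
hence constant.
\<close>
lemma image_ne_sphere: "f ` ball 0 1 \<noteq> UNIV"
proof
  assume surj: "f ` ball 0 1 = UNIV"
  define E where "E = ball 0 1 - {z \<in> ball 0 1. f z = None}"
  have injc: "inj_on (complex_part f) E"
  proof (rule inj_onI)
    fix x y assume xy: "x \<in> E" "y \<in> E" "complex_part f x = complex_part f y"
    then have "f x = f y" using f_eq_Some[of x] f_eq_Some[of y] by (simp add: E_def)
    then show "x = y" using xy by (intro inj_onD[OF inj]) (auto simp: E_def)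
  qed
  obtain h where h: "h holomorphic_on (complex_part f ` E)" "\<And>z. z \<in> E \<Longrightarrow> h (complex_part f z) = z"
    by (rule holomorphic_has_inverse[OF complex_part_holomorphic[folded E_def] open_nonpoles[folded E_def] injc])
      blast
  have onto: "\<exists>z\<in>E. complex_part f z = w" for w
  proof -
    have "Some w \<in> f ` ball 0 1" using surj by simp
    then obtain z where "z \<in> ball 0 1" "f z = Some w" by (metis imageE)
    then show ?thesis by (intro bexI[of _ z]) (auto simp: E_def complex_part_def)
  qed
  have img: "complex_part f ` E = UNIV"
  proof (rule UNIV_eq_I[THEN sym])
    show "w \<in> complex_part f ` E" for w using onto[of w] by blast
  qed
  have "range h \<subseteq> ball 0 1"
  proof (rule image_subsetI)
    fix w
    obtain z where "z \<in> E" "complex_part f z = w" using onto by blast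
    then show "h w \<in> ball 0 1" using h(2)[of z] by (auto simp: E_def)
  qed
  then have "bounded (range h)" by (rule bounded_subset[OF bounded_ball])
  then have "h constant_on UNIV" using Liouville_theorem h(1) img by simp
  then obtain k where k: "\<And>w. h w = k" by (auto simp: constant_on_def)
  obtain z0 where "z0 \<in> E" "complex_part f z0 = 0" using onto by blast
  moreover obtain z1 where "z1 \<in> E" "complex_part f z1 = 1" using onto by blast
  ultimately show False using h(2) k by (metis zero_neq_one)
qed

context
  fixes \<alpha> \<beta> :: complex
  assumes nz: "\<alpha> \<noteq> 0 \<or> \<beta> \<noteq> 0"
    and fin: "\<And>w. Some w \<in> f ` ball 0 1 \<Longrightarrow> cmod (\<alpha> * w + \<beta>) \<le> cmod (cnj \<alpha> - cnj \<beta> * w)"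
    and inf: "None \<in> f ` ball 0 1 \<Longrightarrow> cmod \<alpha> \<le> cmod \<beta>"
begin

private abbreviation "rotated \<equiv> rotated_part f \<alpha> \<beta>"

lemma determinant_pos: "0 < (cmod \<alpha>)\<^sup>2 + (cmod \<beta>)\<^sup>2"
  using nz by (auto simp: add_pos_nonneg add_nonneg_pos)

lemma determinant_ne_0: "\<alpha> * cnj \<alpha> + \<beta> * cnj \<beta> \<noteq> 0"
proof -
  have "\<alpha> * cnj \<alpha> + \<beta> * cnj \<beta> = of_real ((cmod \<alpha>)\<^sup>2 + (cmod \<beta>)\<^sup>2)"
    by (simp only: complex_norm_square of_real_add)
  then show ?thesis using determinant_pos by (metis less_irrefl of_real_eq_0_iff)
qed

lemma numerator_le:
  assumes "z \<in> ball 0 1" "f z = Some w"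
  shows "cmod (\<alpha> * w + \<beta>) \<le> cmod (- cnj \<beta> * w + cnj \<alpha>)"
proof -
  have "Some w \<in> f ` ball 0 1" using assms by (metis imageI)
  moreover have "- cnj \<beta> * w + cnj \<alpha> = cnj \<alpha> - cnj \<beta> * w" by simp
  ultimately show ?thesis using fin by metis
qed

lemma denominator_ne_0:
  assumes "z \<in> ball 0 1" "f z = Some w" shows "- cnj \<beta> * w + cnj \<alpha> \<noteq> 0"
proof
  assume 0: "- cnj \<beta> * w + cnj \<alpha> = 0"
  have "cmod (\<alpha> * w + \<beta>) \<le> cmod (- cnj \<beta> * w + cnj \<alpha>)" by (rule numerator_le[OF assms])
  then have "\<alpha> * w + \<beta> = 0" using 0 by simp
  then have "\<alpha> * cnj \<alpha> + \<beta> * cnj \<beta> = 0" using 0 by algebra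
  then show False using determinant_ne_0 by blast
qed

lemma beta_ne_0: "z \<in> ball 0 1 \<Longrightarrow> f z = None \<Longrightarrow> \<beta> \<noteq> 0"
  using inf nz by (metis imageI norm_le_zero_iff norm_zero)

lemma norm_rotated_le:
  assumes "z \<in> ball 0 1" shows "cmod (rotated z) \<le> 1"
proof (cases "f z")
  case None
  then have "cmod \<alpha> \<le> cmod \<beta>" using inf assms by (metis imageI)
  then show ?thesis using beta_ne_0[OF assms None] by (simp add: rotated_part_def None norm_divide divide_le_eq)
next
  case (Some w)
  have "cmod (\<alpha> * w + \<beta>) \<le> cmod (- cnj \<beta> * w + cnj \<alpha>)" by (rule numerator_le[OF assms Some])
  then show ?thesis using denominator_ne_0[OF assms Some] by (simp add: rotated_part_def Some norm_divide divide_le_eq)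
qed

lemma inj_on_rotated: "inj_on rotated (ball 0 1)"
proof (rule inj_onI)
  fix x y assume xy: "x \<in> ball 0 1" "y \<in> ball 0 1" "rotated x = rotated y"
  have mixed: False if "u \<in> ball 0 1" "v \<in> ball 0 1" "f u = None" "f v = Some w" "rotated u = rotated v" for u v w
  proof -
    have "cnj \<beta> \<noteq> 0" using beta_ne_0[OF that(1,3)] by simp
    moreover have "- (\<alpha> / cnj \<beta>) = (\<alpha> * w + \<beta>) / (- cnj \<beta> * w + cnj \<alpha>)"
      using that(5) by (simp add: rotated_part_def that(3,4))
    ultimately have "- \<alpha> * (- cnj \<beta> * w + cnj \<alpha>) = (\<alpha> * w + \<beta>) * cnj \<beta>"
      using denominator_ne_0[OF that(2,4)] by (simp add: divide_simps)
    then have "\<alpha> * cnj \<alpha> + \<beta> * cnj \<beta> = 0" by algebra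
    then show False using determinant_ne_0 by blast
  qed
  have "f x = f y"
  proof (cases "f x"; cases "f y")
    fix v w assume vw: "f x = Some v" "f y = Some w"
    have "(\<alpha> * v + \<beta>) / (- cnj \<beta> * v + cnj \<alpha>) = (\<alpha> * w + \<beta>) / (- cnj \<beta> * w + cnj \<alpha>)"
      using xy(3) by (simp add: rotated_part_def vw)
    then have "(\<alpha> * v + \<beta>) * (- cnj \<beta> * w + cnj \<alpha>) = (\<alpha> * w + \<beta>) * (- cnj \<beta> * v + cnj \<alpha>)"
      using denominator_ne_0[OF xy(1) vw(1)] denominator_ne_0[OF xy(2) vw(2)] by (simp add: frac_eq_eq)
    then have "(\<alpha> * cnj \<alpha> + \<beta> * cnj \<beta>) * (v - w) = 0" by algebra
    then show ?thesis using determinant_ne_0 vw by simp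
  qed (use mixed xy in \<open>auto dest: sym\<close>)
  then show "x = y" using inj xy by (auto dest: inj_onD)
qed

lemma rotated_eq:
  assumes "f z \<noteq> None"
  shows "rotated z = (\<alpha> * complex_part f z + \<beta>) / (- cnj \<beta> * complex_part f z + cnj \<alpha>)"
  using assms by (auto simp: rotated_part_def complex_part_def)

text \<open>
The function is continuous at a pole of \<open>f\<close>, where the rotation takes infinity to \<open>- \<alpha> / cnj \<beta>\<close>; this
removes the singularity.
\<close>
lemma rotated_holomorphic: "rotated holomorphic_on ball 0 1"
proof (rule no_isolated_singularity'[where K = "{z \<in> ball 0 1. f z = None}"])
  have "(\<lambda>z. (\<alpha> * complex_part f z + \<beta>) / (- cnj \<beta> * complex_part f z + cnj \<alpha>))
      holomorphic_on ball 0 1 - {z \<in> ball 0 1. f z = None}"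
    using denominator_ne_0 f_eq_Some
    by (intro holomorphic_intros complex_part_holomorphic) blast
  then show "rotated holomorphic_on ball 0 1 - {z \<in> ball 0 1. f z = None}"
    by (rule holomorphic_transform) (auto simp: rotated_eq)
  fix p assume "p \<in> {z \<in> ball 0 1. f z = None}"
  then have p: "p \<in> ball 0 1" "f p = None" by auto
  have b: "cnj \<beta> \<noteq> 0" using beta_ne_0[OF p] by simp
  let ?d = "\<lambda>z. cnj \<alpha> + - cnj \<beta> * complex_part f z"
  have "is_pole (complex_part f) p" using mero p unfolding meromorphic_map_on_def by blast
  then have "filterlim (complex_part f) at_infinity (at p)" by (simp add: is_pole_def)
  then have "filterlim ?d at_infinity (at p)"
    using b by (intro tendsto_add_filterlim_at_infinity[OF tendsto_const]
        tendsto_mult_filterlim_at_infinity[OF tendsto_const]) auto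
  then have "((\<lambda>z. - (\<alpha> / cnj \<beta>) + (\<beta> + \<alpha> * cnj \<alpha> / cnj \<beta>) / ?d z) \<longlongrightarrow> - (\<alpha> / cnj \<beta>) + 0) (at p)"
    by (intro tendsto_add tendsto_const tendsto_divide_0[OF tendsto_const])
  moreover have "\<forall>\<^sub>F z in at p. - (\<alpha> / cnj \<beta>) + (\<beta> + \<alpha> * cnj \<alpha> / cnj \<beta>) / ?d z = rotated z"
  proof -
    have "\<forall>\<^sub>F z in at p. z \<in> ball 0 1 - {p}" using p(1) by (intro eventually_at_in_open) auto
    then show ?thesis
    proof (rule eventually_mono)
      fix z assume z: "z \<in> ball 0 1 - {p}"
      then have fz: "f z \<noteq> None" using pole_unique[of z p] p by blast
      have "- cnj \<beta> * complex_part f z + cnj \<alpha> \<noteq> 0"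
        using denominator_ne_0[of z] z f_eq_Some[OF fz] by blast
      then show "- (\<alpha> / cnj \<beta>) + (\<beta> + \<alpha> * cnj \<alpha> / cnj \<beta>) / ?d z = rotated z"
        using b unfolding rotated_eq[OF fz] by (simp add: divide_simps) (simp add: algebra_simps)
    qed
  qed
  ultimately have "(rotated \<longlongrightarrow> - (\<alpha> / cnj \<beta>) + 0) (at p)"
    by (rule Lim_transform_eventually)
  then have "(rotated \<longlongrightarrow> rotated p) (at p)" by (simp add: rotated_part_def p)
  then show "(rotated \<longlongrightarrow> rotated p) (at p within ball 0 1)" by (rule tendsto_within_subset) simp
qed (use finite_poles in auto)

text \<open>
The image is an open subset of the closed unit disc.
\<close>
lemma norm_rotated_less:
  assumes "cmod z < 1" shows "cmod (rotated z) < 1"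
proof -
  have "open (rotated ` ball 0 1)"
    using open_mapping_thm3[OF rotated_holomorphic open_ball inj_on_rotated] .
  moreover have "rotated ` ball 0 1 \<subseteq> cball 0 1" using norm_rotated_le by auto
  ultimately have "rotated ` ball 0 1 \<subseteq> ball 0 1" by (metis interior_cball interior_maximal)
  then show ?thesis using assms by (auto simp: image_subset_iff)
qed

lemma spherical_deriv_rotated:
  assumes "z \<in> ball 0 1 - {z \<in> ball 0 1. f z = None}"
  shows "(spherical_deriv f z)\<^sup>2 = spherical_density rotated z"
proof -
  let ?c = "complex_part f"
  have fz: "f z \<noteq> None" and z: "z \<in> ball 0 1" using assms by auto
  have d0: "- cnj \<beta> * ?c z + cnj \<alpha> \<noteq> 0" using denominator_ne_0[OF z f_eq_Some[OF fz]] .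
  have "(?c has_field_derivative deriv ?c z) (at z)"
    by (rule holomorphic_derivI[OF complex_part_holomorphic open_nonpoles assms])
  note D = unitary_moebius_deriv[OF this d0, of \<alpha> \<beta>]
  have "(rotated has_field_derivative
      (\<alpha> * cnj \<alpha> - \<beta> * - cnj \<beta>) * deriv ?c z / (- cnj \<beta> * ?c z + cnj \<alpha>)\<^sup>2) (at z)"
    by (rule has_field_derivative_transform_within_open[OF D open_nonpoles assms]) (auto simp: rotated_eq)
  then have "deriv rotated z = (\<alpha> * cnj \<alpha> - \<beta> * - cnj \<beta>) * deriv ?c z / (- cnj \<beta> * ?c z + cnj \<alpha>)\<^sup>2"
    by (rule DERIV_imp_deriv)
  then have "cmod (deriv rotated z) / (1 + (cmod (rotated z))\<^sup>2) = cmod (deriv ?c z) / (1 + (cmod (?c z))\<^sup>2)"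
    unfolding rotated_eq[OF fz]
    using unitary_moebius_isometry[of \<alpha> "- cnj \<beta>" "(cmod \<alpha>)\<^sup>2 + (cmod \<beta>)\<^sup>2" \<beta> "cnj \<alpha>" "?c z" "deriv ?c z"]
      d0 determinant_pos by (simp add: mult.commute)
  then show ?thesis
    unfolding spherical_deriv_at_nonpole[of f z, OF fz] spherical_density_def power_divide[symmetric] by simp
qed

text \<open>
The map is recovered as \<open>f z = (cnj \<alpha> \<eta> z - \<beta>) / (\<alpha> + cnj \<beta> \<eta> z)\<close>. Division of numerator and
denominator by \<open>\<alpha>\<close> gives the first kind of elements of \<open>Rot\<close>; the second kind is the case \<open>\<alpha> = 0\<close>.
\<close>
lemma rotated_rotation_imp_isometry:
  assumes \<eta>: "cmod \<eta> = 1" and rot: "\<And>z. cmod z < 1 \<Longrightarrow> rotated z = \<eta> * z"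
  shows "spherical_isometry_on_disc f"
proof -
  have f: "f z = (if \<alpha> + \<eta> * z * cnj \<beta> = 0 then None
      else Some ((\<eta> * z * cnj \<alpha> - \<beta>) / (\<alpha> + \<eta> * z * cnj \<beta>)))" if z: "z \<in> ball 0 1" for z
  proof (cases "f z")
    case None
    then have "- (\<alpha> / cnj \<beta>) = \<eta> * z" using rot[of z] z by (simp add: rotated_part_def)
    then have "\<alpha> + \<eta> * z * cnj \<beta> = 0" using beta_ne_0[OF z None]
      by (metis add.right_inverse complex_cnj_zero_iff minus_divide_left nonzero_divide_eq_eq)
    then show ?thesis using None by simp
  next
    case (Some w)
    have "(\<alpha> * w + \<beta>) / (- cnj \<beta> * w + cnj \<alpha>) = \<eta> * z" using rot[of z] z by (simp add: rotated_part_def Some)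
    then have e: "\<alpha> * w + \<beta> = \<eta> * z * (- cnj \<beta> * w + cnj \<alpha>)"
      using denominator_ne_0[OF z Some] by (simp add: divide_eq_eq)
    have "\<alpha> + \<eta> * z * cnj \<beta> \<noteq> 0"
    proof
      assume "\<alpha> + \<eta> * z * cnj \<beta> = 0"
      then have "\<alpha> * cnj \<alpha> + \<beta> * cnj \<beta> = 0" using e by algebra
      then show False using determinant_ne_0 by blast
    qed
    moreover have "w * (\<alpha> + \<eta> * z * cnj \<beta>) = \<eta> * z * cnj \<alpha> - \<beta>" using e by algebra
    ultimately show ?thesis using Some by (simp add: eq_divide_eq)
  qed
  show ?thesis
  proof (cases "\<alpha> = 0")
    case True
    then have b: "\<beta> \<noteq> 0" using nz by simp
    define u where "u = - \<beta> / (cnj \<beta> * \<eta>)"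
    have "\<eta> \<noteq> 0" using \<eta> by auto
    have "cmod u = 1" using b \<eta> by (simp add: u_def norm_divide norm_mult)
    then obtain \<theta> where \<theta>: "u = cis \<theta>" by (metis complex_norm_eq_1_exp cis_conv_exp)
    have "f z = sphere_moebius 0 (cis \<theta>) 1 0 (Some z)" if "z \<in> ball 0 1" for z
      using f[OF that] b \<open>\<eta> \<noteq> 0\<close> by (simp add: True moebius_def u_def flip: \<theta>)
    then show ?thesis unfolding spherical_isometry_on_disc_def Rot_def by blast
  next
    case False
    define u where "u = \<eta> * cnj \<alpha> / \<alpha>"
    define a where "a = \<beta> / (cnj \<alpha> * \<eta>)"
    have "\<eta> \<noteq> 0" using \<eta> by auto
    have e1: "\<eta> * cnj \<eta> = 1" using \<eta> by (simp add: complex_norm_square[symmetric])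
    have "cmod u = 1" using False \<eta> by (simp add: u_def norm_divide norm_mult)
    then obtain \<theta> where \<theta>: "u = cis \<theta>" by (metis complex_norm_eq_1_exp cis_conv_exp)
    have ca: "cnj a = cnj \<beta> * \<eta> / \<alpha>"
    proof -
      have "cnj \<eta> \<noteq> 0" using \<open>\<eta> \<noteq> 0\<close> by simp
      then show ?thesis using False e1 by (simp add: a_def divide_simps)
    qed
    have ua: "u * a = \<beta> / \<alpha>" using False \<open>\<eta> \<noteq> 0\<close> by (simp add: u_def a_def)
    have "f z = sphere_moebius u (- (u * a)) (cnj a) 1 (Some z)" if z: "z \<in> ball 0 1" for z
    proof -
      have den: "cnj a * z + 1 = (\<alpha> + \<eta> * z * cnj \<beta>) / \<alpha>"
        using False unfolding ca by (simp add: divide_simps)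
      moreover have "u * z + - (u * a) = (\<eta> * z * cnj \<alpha> - \<beta>) / \<alpha>"
        using False unfolding ua by (simp add: u_def divide_simps)
      ultimately show ?thesis using f[OF z] False by (simp add: moebius_def)
    qed
    then show ?thesis unfolding spherical_isometry_on_disc_def Rot_def \<theta> by blast
  qed
qed

end
end

section \<open>The monotonicity theorem\<close>
lemma spherical_isometry_area:
  assumes inj: "inj_on f (ball 0 1)" and iso: "spherical_isometry_on_disc f" and r: "r < 1"
  shows "spherical_area_image f r = spherical_area_disc r"
proof -
  obtain T where T: "T \<in> Rot" "\<And>z. z \<in> ball 0 1 \<Longrightarrow> f z = T (Some z)"
    using iso by (auto simp: spherical_isometry_on_disc_def)
  have u: "cmod (cis \<theta>) = 1" for \<theta> by simp
  obtain A B C D s where Tm: "T = sphere_moebius A B C D"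
    and len: "(cmod A)\<^sup>2 + (cmod C)\<^sup>2 = s" "(cmod B)\<^sup>2 + (cmod D)\<^sup>2 = s" "s > 0"
    and orth: "A * cnj B + C * cnj D = 0"
  proof -
    from T(1) consider a \<theta> where "T = sphere_moebius (cis \<theta>) (- (cis \<theta> * a)) (cnj a) 1"
      | \<theta> where "T = sphere_moebius 0 (cis \<theta>) 1 0" unfolding Rot_def by blast
    then show thesis
    proof cases
      case 1
      have "cis \<theta> * cnj (- (cis \<theta> * a)) + cnj a * cnj 1 = 0"
        by (simp add: cis_cnj cis_mult mult.assoc[symmetric])
      then show ?thesis
        using 1 by (intro that[of "cis \<theta>" "- (cis \<theta> * a)" "cnj a" 1 "1 + (cmod a)\<^sup>2"])
          (auto simp: norm_mult add_pos_nonneg)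
    next
      case 2
      then show ?thesis by (intro that[of 0 "cis \<theta>" 1 0 1]) auto
    qed
  qed
  define K where "K = {z \<in> ball 0 1. f z = None}"
  have "K = f -` {None} \<inter> ball 0 1" by (auto simp: K_def)
  then have K: "finite K" using finite_vimage_IntI[OF _ inj, of "{None}"] by simp
  let ?c = "complex_part f"
  have c: "C * z + D \<noteq> 0" "?c z = (A * z + B) / (C * z + D)" if "z \<in> ball 0 1 - K" for z
    using T(2)[of z] that by (auto simp: Tm K_def complex_part_def moebius_def split: if_splits)
  have op: "open (ball 0 1 - K)" using K by (intro open_Diff open_ball finite_imp_closed)
  have "(spherical_deriv f z)\<^sup>2 = spherical_density (\<lambda>z. z) z" if z: "z \<in> ball 0 1 - K" for z
  proof -
    have "((\<lambda>z. (A * z + B) / (C * z + D)) has_field_derivative (A * D - B * C) * 1 / (C * z + D)\<^sup>2) (at z)"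
      using unitary_moebius_deriv[OF DERIV_ident, of C z D A B] c(1)[OF z] by simp
    then have "(?c has_field_derivative (A * D - B * C) * 1 / (C * z + D)\<^sup>2) (at z)"
      by (rule has_field_derivative_transform_within_open[OF _ op z]) (simp add: c)
    then have "deriv ?c z = (A * D - B * C) * 1 / (C * z + D)\<^sup>2" by (rule DERIV_imp_deriv)
    then have "cmod (deriv ?c z) / (1 + (cmod (?c z))\<^sup>2) = cmod 1 / (1 + (cmod z)\<^sup>2)"
      unfolding c(2)[OF z] using unitary_moebius_isometry[OF len orth c(1)[OF z], of 1] by simp
    moreover have "f z \<noteq> None" using z by (auto simp: K_def)
    ultimately show ?thesis
      using spherical_deriv_at_nonpole[of f z]
      unfolding spherical_density_def power_divide[symmetric] by simp
  qed
  then show ?thesis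
    unfolding spherical_area_disc_eq using K r by (intro spherical_area_image_eq holomorphic_on_ident)
qed

theorem theorem1p2:
  fixes f :: "complex \<Rightarrow> riemann_sphere"
  assumes "spherically_convex_map f"
  shows "(\<not> spherical_isometry_on_disc f \<longrightarrow>
            strict_mono_on {0<..<1} (spherical_area_ratio f)) \<and>
         (spherical_isometry_on_disc f \<longrightarrow>
            (\<forall>r\<in>{0<..<1}. spherical_area_ratio f r = 1))"
proof (intro conjI impI)
  have mero: "meromorphic_map_on f (ball 0 1)" and inj: "inj_on f (ball 0 1)"
    and conv: "spherically_convex_domain (f ` ball 0 1)"
    using assms by (auto simp: spherically_convex_map_def)
  show "\<forall>r\<in>{0<..<1}. spherical_area_ratio f r = 1" if "spherical_isometry_on_disc f"
  proof
    fix r :: real assume r: "r \<in> {0<..<1}"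
    then have "spherical_area_disc r > 0"
      by (simp add: spherical_area_disc_eq image_area_id add_pos_nonneg)
    then show "spherical_area_ratio f r = 1"
      using spherical_isometry_area[OF inj that, of r] r by (simp add: spherical_area_ratio_def)
  qed
  assume not_iso: "\<not> spherical_isometry_on_disc f"
  obtain e where "\<And>p. p \<in> f ` ball 0 1 \<Longrightarrow> 0 \<le> to_unit_sphere e \<bullet> to_unit_sphere p"
    using spherically_convex_in_hemisphere[OF conv image_ne_sphere[OF mero inj]] by blast
  from unitary_coefficients_of_hemisphere[OF this] obtain \<alpha> \<beta> where ab: "\<alpha> \<noteq> 0 \<or> \<beta> \<noteq> 0"
    "\<And>w. Some w \<in> f ` ball 0 1 \<Longrightarrow> cmod (\<alpha> * w + \<beta>) \<le> cmod (cnj \<alpha> - cnj \<beta> * w)"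
    "None \<in> f ` ball 0 1 \<Longrightarrow> cmod \<alpha> \<le> cmod \<beta>" by blast
  note ctx = mero inj ab
  define g where "g = rotated_part f \<alpha> \<beta>"
  have hol: "g holomorphic_on ball 0 1" unfolding g_def by (rule rotated_holomorphic[OF ctx])
  have "strict_mono_on {0<..<1} (\<lambda>r. image_area g r / image_area (\<lambda>z. z) r)"
  proof (rule area_ratio_strict_mono[OF hol])
    show "inj_on g (ball 0 1)" unfolding g_def by (rule inj_on_rotated[OF ctx])
    show "cmod (g z) < 1" if "cmod z < 1" for z unfolding g_def by (rule norm_rotated_less[OF ctx that])
    show "\<nexists>\<eta>. cmod \<eta> = 1 \<and> (\<forall>z. cmod z < 1 \<longrightarrow> g z = \<eta> * z)"
      using rotated_rotation_imp_isometry[OF ctx] not_iso unfolding g_def by blast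
  qed
  moreover have "spherical_area_ratio f r = image_area g r / image_area (\<lambda>z. z) r" if "r \<in> {0<..<1}" for r
    using spherical_area_image_eq[OF hol finite_poles[OF mero inj], of f r] spherical_deriv_rotated[OF ctx] that
    unfolding g_def by (simp add: spherical_area_ratio_def spherical_area_disc_eq)
  ultimately show "strict_mono_on {0<..<1} (spherical_area_ratio f)"
    by (simp add: strict_mono_on_def)
qed

end
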